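(* Let $X$ be a finite connected graph without bridges, with a chosen basepoint $x_0$. Let $V$ be the set of vertices of $X$ and $T$ the set of spanning trees in $X$. Let $$A=\{\pi(c_\alpha) : \alpha\colon x_0\to x \text{ a path in } X, \text{ for some } x\in V\},\qquad L=\{\pi(c): c\in C_1(X,\mathbb{Z})\},$$ both subsets of $Z_1(X,\mathbb{R})$ on which $Z_1(X,\mathbb{Z})$ acts by translations. Then the packing fraction of $X$ is $$\frac{|A/Z_1(X,\mathbb{Z})|}{|L/Z_1(X,\mathbb{Z})|}=\frac{|V|}{|T|}.$$ In fact $|A/Z_1(X,\mathbb{Z})|=|V|$ and $|L/Z_1(X,\mathbb{Z})|=|T|$.
   Context: Graphs. A graph $X=(E,V,s,t,\mathrm{inv})$ consists of a set $V$ of vertices, a set $E$ of edges, source and target maps $s,t\colon E\to V$, and a map $\mathrm{inv}\colon E\to E$, $e\mapsto e^{-1}$, with $s(e^{-1})=t(e)$, $t(e^{-1})=s(e)$, $(e^{-1})^{-1}=e$ and $e^{-1}\neq e$ for all $e$. Write $e\colon v\to w$ if $s(e)=v$, $t(e)=w$. (Multiple edges and self-loops are allowed; each pair $\{e,e^{-1}\}$ represents one undirected edge, and spanning trees are those of the corresponding undirected multigraph.) An edge $e$ is a bridge if removing it (together with $e^{-1}$) disconnects the graph. A path $\gamma\colon x\to y$ is a word of edges $\gamma=e_1\cdots e_\ell$ with $e_k\colon v_{k-1}\to v_k$, $v_0=x$, $v_\ell=y$; the empty word is allowed iff $x=y$. Chains. $C_0(X,\mathbb{Z})$ is the free abelian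 group on $V$; $C_1(X,\mathbb{Z})$ is the free abelian group on $E$ modulo the relations $e^{-1}=-e$; $\partial e=t(e)-s(e)$; $Z_1(X,\mathbb{Z})=\ker(\partial\colon C_1(X,\mathbb{Z})\to C_0(X,\mathbb{Z}))$. $C_k(X,\mathbb{R})=C_k(X,\mathbb{Z})\otimes\mathbb{R}$, and $Z_1(X,\mathbb{R})=\ker(\partial\colon C_1(X,\mathbb{R})\to C_0(X,\mathbb{R}))$. $C_1(X,\mathbb{R})$ has the inner product for which edges form an orthonormal basis (one edge chosen from each pair $\{e,e^{-1}\}$, with $e^{-1}=-e$), and $\pi\colon C_1(X,\mathbb{R})\to Z_1(X,\mathbb{R})$ is the orthogonal projection. For a path $\gamma=e_1\cdots e_n$, $c_\gamma=e_1+\cdots+e_n$. Here $Z_1(X,\mathbb{Z})\subseteq A\subseteq L$, $A/Z_1(X,\mathbb{Z})$ is the set of orbits of $A$ under translation by $Z_1(X,\mathbb{Z})$, and $L/Z_1(X,\mathbb{Z})$ is the quotient group. The packing fraction is by definition the ratio $|A/Z_1(X,\mathbb{Z})|/|L/Z_1(X,\mathbb{Z})|$. *)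

theory Defs
  imports Complex_Main "HOL-Algebra.Group_Action" "Graph_Theory.Graph_Theory"
begin

text \<open>
  Graphs are finite digraphs with an arc-reversing involution, i.e. the locales
  \<^locale>\<open>bidirected_digraph\<close> and \<^locale>\<open>fin_digraph\<close>: \<^term>\<open>arev\<close> is \<open>e \<mapsto> e\<inverse>\<close>, fixed-point
  free on the arcs (and by convention the identity outside of them). Loops and
  parallel edges are allowed. The predicate \<^const>\<open>Digraph_Component.connected\<close> is
  connectedness of the underlying undirected graph.
\<close>

definition bridge :: "('v, 'e) pre_digraph \<Rightarrow> ('e \<Rightarrow> 'e) \<Rightarrow> 'e \<Rightarrow> bool" where
  "bridge G arev e \<longleftrightarrow> e \<in> arcs G \<and>
     \<not> Digraph_Component.connected (pre_digraph.del_arc (pre_digraph.del_arc G e) (arev e))"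

text \<open>
  \<^const>\<open>spanning_tree\<close> from the library is about directed cycles: it neither asks the
  subgraph to be closed under reversal nor discounts the directed 2-cycle formed by an
  edge and its reverse. Hence the following notions for undirected multigraphs.
  A cycle traverses no edge in both directions; loops and pairs of parallel edges are cycles.
\<close>

definition undirected_cycle :: "('v, 'e) pre_digraph \<Rightarrow> ('e \<Rightarrow> 'e) \<Rightarrow> 'e list \<Rightarrow> bool" where
  "undirected_cycle G arev p \<longleftrightarrow> pre_digraph.cycle G p \<and> (\<forall>e \<in> set p. arev e \<notin> set p)"

definition undirected_spanning_trees ::
    "('v, 'e) pre_digraph \<Rightarrow> ('e \<Rightarrow> 'e) \<Rightarrow> ('v, 'e) pre_digraph set" where
  "undirected_spanning_trees G arev =
     {H. spanning H G \<and> arev ` arcs H \<subseteq> arcs H \<and> Digraph_Component.connected H \<and>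
         (\<nexists>p. undirected_cycle H arev p)}"

text \<open>
  \<open>C\<^sub>1(X, K)\<close>, for \<open>K = \<int>\<close> or \<open>K = \<real>\<close>, is realised as the antisymmetric \<open>K\<close>-valued functions
  on arcs (extended by 0), where the generator \<open>e\<close> becomes \<open>\<delta>\<^sub>e - \<delta>\<^sub>e\<^sub>'\<close> with \<open>e' = e\<inverse>\<close>. The
  lemmas \<open>chains_presentation_generators\<close> and \<open>chains_presentation_relations\<close> show that this is the module generated by the arcs modulo
  \<open>e\<inverse> = -e\<close>. In this model \<open>C\<^sub>1(X, \<int>)\<close> is literally a subset of \<open>C\<^sub>1(X, \<real>)\<close>.
\<close>

definition chains1 :: "('v, 'e) pre_digraph \<Rightarrow> ('e \<Rightarrow> 'e) \<Rightarrow> real set \<Rightarrow> ('e \<Rightarrow> real) set" where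
  "chains1 G arev K =
     {c. (\<forall>e \<in> arcs G. c e \<in> K \<and> c (arev e) = - c e) \<and> (\<forall>e. e \<notin> arcs G \<longrightarrow> c e = 0)}"

definition edge_chain :: "('e \<Rightarrow> 'e) \<Rightarrow> 'e \<Rightarrow> 'e \<Rightarrow> real" where
  "edge_chain arev e f = of_bool (f = e) - of_bool (f = arev e)"

definition path_chain :: "('e \<Rightarrow> 'e) \<Rightarrow> 'e list \<Rightarrow> 'e \<Rightarrow> real" where
  "path_chain arev p f = (\<Sum>e\<leftarrow>p. edge_chain arev e f)"

text \<open>The sum runs over both orientations of each edge, whence the factor \<open>1/2\<close>.\<close>

definition boundary :: "('v, 'e) pre_digraph \<Rightarrow> ('e \<Rightarrow> real) \<Rightarrow> 'v \<Rightarrow> real" where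
  "boundary G c v =
     (\<Sum>e \<in> arcs G. c e * (of_bool (v = head G e) - of_bool (v = tail G e))) / 2"

definition cycles :: "('v, 'e) pre_digraph \<Rightarrow> ('e \<Rightarrow> 'e) \<Rightarrow> real set \<Rightarrow> ('e \<Rightarrow> real) set" where
  "cycles G arev K = {c \<in> chains1 G arev K. \<forall>v \<in> verts G. boundary G c v = 0}"

text \<open>Again each edge is counted with both orientations.\<close>

definition chain_inner :: "('v, 'e) pre_digraph \<Rightarrow> ('e \<Rightarrow> real) \<Rightarrow> ('e \<Rightarrow> real) \<Rightarrow> real" where
  "chain_inner G c d = (\<Sum>e \<in> arcs G. c e * d e) / 2"

definition cycle_proj ::
    "('v, 'e) pre_digraph \<Rightarrow> ('e \<Rightarrow> 'e) \<Rightarrow> ('e \<Rightarrow> real) \<Rightarrow> 'e \<Rightarrow> real" where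
  "cycle_proj G arev c =
     (THE z. z \<in> cycles G arev \<real> \<and>
        (\<forall>w \<in> cycles G arev \<real>. chain_inner G (\<lambda>e. c e - z e) w = 0))"

definition atoms :: "('v, 'e) pre_digraph \<Rightarrow> ('e \<Rightarrow> 'e) \<Rightarrow> 'v \<Rightarrow> ('e \<Rightarrow> real) set" where
  "atoms G arev x\<^sub>0 =
     {cycle_proj G arev (path_chain arev p) | p x. x \<in> verts G \<and> pre_digraph.awalk G x\<^sub>0 p x}"

definition proj_lattice :: "('v, 'e) pre_digraph \<Rightarrow> ('e \<Rightarrow> 'e) \<Rightarrow> ('e \<Rightarrow> real) set" where
  "proj_lattice G arev = cycle_proj G arev ` chains1 G arev \<int>"

definition chain_group :: "('e \<Rightarrow> real) set \<Rightarrow> ('e \<Rightarrow> real) monoid" where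
  "chain_group C = \<lparr>carrier = C, monoid.mult = (\<lambda>c d e. c e + d e), one = (\<lambda>_. 0)\<rparr>"

text \<open>Restricted to \<open>S\<close> because \<^const>\<open>BijGroup\<close> consists of extensional functions.\<close>

definition translation :: "('e \<Rightarrow> real) set \<Rightarrow> ('e \<Rightarrow> real) \<Rightarrow> ('e \<Rightarrow> real) \<Rightarrow> 'e \<Rightarrow> real" where
  "translation S z = (\<lambda>a \<in> S. \<lambda>e. a e + z e)"

definition atom_orbits ::
    "('v, 'e) pre_digraph \<Rightarrow> ('e \<Rightarrow> 'e) \<Rightarrow> 'v \<Rightarrow> ('e \<Rightarrow> real) set set" where
  "atom_orbits G arev x\<^sub>0 =
     orbits (chain_group (cycles G arev \<int>)) (atoms G arev x\<^sub>0) (translation (atoms G arev x\<^sub>0))"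

definition lattice_quotient ::
    "('v, 'e) pre_digraph \<Rightarrow> ('e \<Rightarrow> 'e) \<Rightarrow> ('e \<Rightarrow> real) set monoid" where
  "lattice_quotient G arev = chain_group (proj_lattice G arev) Mod cycles G arev \<int>"

definition packing_fraction :: "('v, 'e) pre_digraph \<Rightarrow> ('e \<Rightarrow> 'e) \<Rightarrow> 'v \<Rightarrow> real" where
  "packing_fraction G arev x\<^sub>0 =
     real (card (atom_orbits G arev x\<^sub>0)) / real (order (lattice_quotient G arev))"


context
  fixes G :: "('v, 'e) pre_digraph" and arev :: "'e \<Rightarrow> 'e"
  assumes bidir: "bidirected_digraph G arev" and fin: "fin_digraph G"
begin

interpretation bidirected_digraph G arev by (rule bidir)
interpretation fin_digraph G by (rule fin)

lemma sum_edge_chain: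
  assumes "e \<in> arcs G"
  shows "(\<Sum>f \<in> arcs G. edge_chain arev e f * g f) = g e - g (arev e)"
proof -
  have "edge_chain arev e f * g f = (if f = e then g f else 0) - (if f = arev e then g f else 0)"
    for f
    by (simp add: edge_chain_def)
  then show ?thesis
    using assms by (simp add: sum_subtractf)
qed

lemma boundary_edge_chain:
  assumes "e \<in> arcs G"
  shows "boundary G (edge_chain arev e) v = of_bool (v = head G e) - of_bool (v = tail G e)"
  using assms by (simp add: boundary_def sum_edge_chain)

lemma chain_inner_edge_chain:
  assumes "e \<in> arcs G" "f \<in> arcs G"
  shows "chain_inner G (edge_chain arev e) (edge_chain arev f) =
    (if f = e then 1 else if f = arev e then - 1 else 0)"
proof -
  have "chain_inner G (edge_chain arev e) (edge_chain arev f) =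
      (edge_chain arev f e - edge_chain arev f (arev e)) / 2"
    using assms by (simp add: chain_inner_def sum_edge_chain)
  moreover have "e = arev f \<longleftrightarrow> f = arev e" "arev e = arev f \<longleftrightarrow> e = f"
    by (metis arev_arev)+
  ultimately show ?thesis
    using assms arev_neq[of e] by (cases "f = e"; cases "f = arev e") (simp_all add: edge_chain_def)
qed

lemma sum_scaled_edge_chain:
  "(\<Sum>e \<in> arcs G. a e * edge_chain arev e f) = (if f \<in> arcs G then a f - a (arev f) else 0)"
proof -
  have "edge_chain arev e f = of_bool (e = f) - of_bool (e = arev f)" for e
    unfolding edge_chain_def
    by (intro arg_cong2[of _ _ _ _ minus] arg_cong[of _ _ of_bool]) (metis arev_arev)+
  then have "a e * edge_chain arev e f = (if e = f then a e else 0) - (if e = arev f then a e else 0)"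
    for e
    by simp
  moreover have "arev f \<in> arcs G \<longleftrightarrow> f \<in> arcs G"
    using arev_in_arcs[of f] arev_in_arcs[of "arev f"] by auto
  ultimately show ?thesis
    by (simp add: sum_subtractf)
qed

lemma chains_presentation_generators:
  assumes K: "K = \<int> \<or> K = \<real>"
  shows "chains1 G arev K =
    {\<lambda>f. \<Sum>e \<in> arcs G. a e * edge_chain arev e f | a. \<forall>e \<in> arcs G. a e \<in> K}" (is "_ = ?R")
proof
  show "?R \<subseteq> chains1 G arev K"
  proof
    fix c assume "c \<in> ?R"
    then obtain a where c: "c = (\<lambda>f. \<Sum>e \<in> arcs G. a e * edge_chain arev e f)"
      and a: "\<forall>e \<in> arcs G. a e \<in> K" by blast
    have "c f = (if f \<in> arcs G then a f - a (arev f) else 0)" for f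
      by (simp only: c sum_scaled_edge_chain)
    moreover have "a f - a (arev f) \<in> K" if "f \<in> arcs G" for f
      using K
    proof
      assume "K = \<int>"
      then show ?thesis using a that by (metis Ints_diff arev_in_arcs)
    next
      assume "K = \<real>"
      then show ?thesis using a that by (metis Reals_diff arev_in_arcs)
    qed
    ultimately show "c \<in> chains1 G arev K"
      by (simp add: chains1_def)
  qed
  show "chains1 G arev K \<subseteq> ?R"
  proof
    fix c assume c: "c \<in> chains1 G arev K"
    define r where "r e = (SOME x. x \<in> {e, arev e})" for e
    have r: "r e = e \<or> r e = arev e" for e
      using someI[of "\<lambda>x. x \<in> {e, arev e}" e] by (auto simp: r_def)
    have r_arev: "r (arev e) = r e" for e
      by (simp add: r_def insert_commute)
    define a where "a e = (if r e = e then c e else 0)" for e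
    have "c f = a f - a (arev f)" if f: "f \<in> arcs G" for f
    proof (cases "r f = f")
      case True
      then show ?thesis using arev_neq[OF f] r_arev[of f] by (simp add: a_def)
    next
      case False
      then have "r f = arev f" using r[of f] by simp
      then show ?thesis using False f c r_arev[of f] by (simp add: a_def chains1_def)
    qed
    then have "c = (\<lambda>f. \<Sum>e \<in> arcs G. a e * edge_chain arev e f)"
      using c unfolding sum_scaled_edge_chain by (intro ext) (simp add: chains1_def)
    moreover have "\<forall>e \<in> arcs G. a e \<in> K"
    proof
      fix e assume "e \<in> arcs G"
      then have "c e \<in> K" "0 \<in> K" using c K by (auto simp: chains1_def)
      then show "a e \<in> K" by (simp add: a_def)
    qed
    ultimately show "c \<in> ?R" by blast
  qed
qed

lemma chains_presentation_relations:
  "(\<forall>f. (\<Sum>e \<in> arcs G. a e * edge_chain arev e f) = 0) \<longleftrightarrow> (\<forall>e \<in> arcs G. a e = a (arev e))"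
proof -
  have *: "(if P then x - y else 0) = 0 \<longleftrightarrow> (P \<longrightarrow> x = y)" for P and x y :: real
    by simp
  show ?thesis
    unfolding sum_scaled_edge_chain * Ball_def ..
qed

end

end

theory Submission
  imports Defs
begin

text \<open>
  Everything takes place in the cokernel of the Laplacian. For an integral chain \<open>c\<close> the projection
  \<open>\<pi> c\<close> differs from \<open>c\<close> by a coboundary \<open>\<delta> h\<close>, because the orthogonal complement of the cycle space
  is the space of coboundaries. If two integral chains have projections that differ by an integral
  cycle, then their own difference is that cycle plus a coboundary, and on a connected
  graph an integral coboundary comes from an integral potential. Applying \<open>\<partial>\<close>, which turns
  \<open>\<delta> h\<close> into the Laplacian of \<open>h\<close>, gives the dictionary on which both counts rest
  (\<open>equivalent_projections_laplacian\<close> and \<open>laplacian_equivalent_projections\<close>): \<open>\<pi> c\<close> and \<open>\<pi> d\<close>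
  are congruent modulo integral cycles iff \<open>\<partial> c - \<partial> d\<close> is the Laplacian of an integer function.

  Atoms. The chain of a path from the basepoint \<open>q\<close> to \<open>x\<close> has boundary \<open>x - q\<close>, so the class of
  its projection depends only on \<open>x\<close>. If \<open>x \<noteq> y\<close> had the same class, \<open>x - y\<close> would be the Laplacian
  of a nonconstant \<open>h\<close>. At each vertex of the set where \<open>h\<close> is maximal, this Laplacian is at least the
  number of arcs that leave the set there. In a bridgeless graph at least two arcs leave the set,
  whereas \<open>x - y\<close> takes the value \<open>1\<close> once and is nonpositive elsewhere (\<open>bridgeless_vertices_inequivalent\<close>). Hence there are
  exactly as many orbits as vertices.

  Lattice. A class of projected integral chains is a class of integer functions on the vertices
  other than \<open>q\<close> modulo Laplacians. Each class contains exactly one parking function: uniqueness is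
  again the maximum principle (\<open>parking_representative_unique\<close>), and existence follows by choosing
  a minimal potential among those that make the function nonnegative
  (\<open>parking_representative_exists\<close>). Parking functions are equinumerous with spanning trees because
  both satisfy the same recursion when an arc leaving the current tree is either added to that
  tree or discarded (\<open>card_parking_eq_card_tree_extensions\<close>); this is Dhar's burning algorithm,
  organised as a deletion-contraction.

  The finiteness of the set of parking functions also yields the projection itself: among
  the multiples of an integral chain two have the same parking function, so some positive multiple
  of its boundary is a Laplacian (\<open>laplacian_multiple\<close>), and dividing by the multiplier gives a real
  potential.
\<close>


section \<open>Trees and parking functions\<close>

locale multigraph = bidirected_digraph G arev + fin_digraph G
  for G :: "('v, 'e) pre_digraph" and arev :: "'e \<Rightarrow> 'e"

lemma (in pre_digraph) walk_crosses_cut: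
  assumes "awalk u p v" "u \<in> A" "v \<notin> A"
  shows "\<exists>e \<in> set p. tail G e \<in> A \<and> head G e \<notin> A"
proof -
  have "cas u p v" using assms by (simp add: awalk_def)
  then show ?thesis using assms(2,3)
    by (induction p arbitrary: u) auto
qed

text \<open>
  Every visit to a vertex arrives and departs, and on a closed walk the first departure is matched by the last arrival.
\<close>

lemma (in pre_digraph) closed_walk_tails_heads:
  assumes "awalk u p u"
  shows "tail G ` set p = head G ` set p"
proof (cases "p = []")
  case False
  have "insert w (tail G ` set p) = insert v (head G ` set p)" if "cas v p w" for v w
    using that by (induction p arbitrary: v) (auto simp: insert_commute)
  moreover have "v \<in> tail G ` set p \<and> w \<in> head G ` set p" if "cas v p w" for v w
    using that False by (induction p arbitrary: v) (auto split: if_splits; metis cas.simps(1))+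
  ultimately show ?thesis using assms unfolding awalk_def by (metis insert_absorb)
qed simp

context multigraph
begin

definition walk_connected :: "'e set \<Rightarrow> 'v set \<Rightarrow> bool" where
  "walk_connected F S \<longleftrightarrow> (\<forall>u \<in> S. \<forall>v \<in> S. \<exists>p. awalk u p v \<and> set p \<subseteq> F)"

definition cycle_free :: "'e set \<Rightarrow> bool" where
  "cycle_free F \<longleftrightarrow> (\<nexists>p. undirected_cycle G arev p \<and> set p \<subseteq> F)"

definition tree_on :: "'v set \<Rightarrow> 'e set \<Rightarrow> bool" where
  "tree_on S F \<longleftrightarrow> S \<subseteq> verts G \<and> F \<subseteq> arcs G \<and> arev ` F \<subseteq> F \<and>
     tail G ` F \<subseteq> S \<and> head G ` F \<subseteq> S \<and> walk_connected F S \<and> cycle_free F"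

text \<open>
  Parking functions of the graph in which \<open>S\<close> is contracted to a sink and only the arcs of \<open>U\<close>
  are kept: no nonempty set of other vertices can fire without some member going into debt. The
  value \<open>0\<close> off these vertices makes equality of parking functions the equality of functions.
\<close>

definition parking :: "'v set \<Rightarrow> 'e set \<Rightarrow> ('v \<Rightarrow> nat) set" where
  "parking S U = {f. (\<forall>v. v \<notin> verts G - S \<longrightarrow> f v = 0) \<and>
     (\<forall>A. A \<noteq> {} \<longrightarrow> A \<subseteq> verts G - S \<longrightarrow>
        (\<exists>v \<in> A. f v < card {e \<in> U. tail G e = v \<and> head G e \<notin> A}))}"

text \<open>
  The spanning trees that contain \<open>F\<close> and otherwise use only arcs of \<open>U\<close>. With \<open>F\<close> a tree on \<open>S\<close>,
  they correspond to the spanning trees of the graph for which \<open>parking S U\<close> is defined.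
\<close>

definition tree_extensions :: "'e set \<Rightarrow> 'e set \<Rightarrow> 'e set set" where
  "tree_extensions F U = {H. F \<subseteq> H \<and> H \<subseteq> F \<union> U \<and> tree_on (verts G) H}"

lemma awalk_restrict:
  assumes "F \<subseteq> arcs G"
  shows "pre_digraph.awalk (G\<lparr>arcs := F\<rparr>) u p v \<longleftrightarrow> awalk u p v \<and> set p \<subseteq> F"
proof -
  have "compatible (G\<lparr>arcs := F\<rparr>) G" by (simp add: compatible_def)
  then show ?thesis
    using assms by (auto simp: pre_digraph.awalk_def compatible_cas)
qed

lemma wf_restrict: "F \<subseteq> arcs G \<Longrightarrow> wf_digraph (G\<lparr>arcs := F\<rparr>)"
  by unfold_locales auto

text \<open>
  Since \<open>F\<close> is closed under reversal, connectedness of the underlying undirected graph is already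
  witnessed by directed walks.
\<close>

lemma connected_restrict_iff:
  assumes "F \<subseteq> arcs G" "arev ` F \<subseteq> F"
  shows "Digraph_Component.connected (G\<lparr>arcs := F\<rparr>) \<longleftrightarrow>
    verts G \<noteq> {} \<and> walk_connected F (verts G)" (is "connected ?H \<longleftrightarrow> _")
proof -
  interpret H: wf_digraph ?H by (rule wf_restrict) fact
  have sym: "symmetric ?H"
    unfolding symmetric_conv
  proof
    fix e assume "e \<in> arcs ?H"
    then have "arev e \<in> arcs ?H" "e \<in> arcs G" using assms by auto
    then show "\<exists>e2\<in>arcs ?H. tail ?H e = head ?H e2 \<and> head ?H e = tail ?H e2"
      by (intro bexI[of _ "arev e"]) auto
  qed
  have "connected ?H \<longleftrightarrow> strongly_connected ?H"
    using H.symmetric_connected_imp_strongly_connected[OF sym]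
    unfolding connected_def strongly_connected_def
    by (auto simp: H.reachable_mk_symmetric_eq[OF sym])
  then show ?thesis
    by (auto simp: strongly_connected_def H.reachable_awalk awalk_restrict[OF assms(1)] walk_connected_def)
qed

lemma undirected_cycle_restrict:
  assumes "F \<subseteq> arcs G"
  shows "undirected_cycle (G\<lparr>arcs := F\<rparr>) arev p \<longleftrightarrow> undirected_cycle G arev p \<and> set p \<subseteq> F"
proof -
  have "compatible (G\<lparr>arcs := F\<rparr>) G" by (simp add: compatible_def)
  then show ?thesis
    by (auto simp: undirected_cycle_def pre_digraph.cycle_def awalk_restrict[OF assms]
        compatible_awalk_verts)
qed

lemma undirected_spanning_trees_eq:
  assumes "verts G \<noteq> {}"
  shows "undirected_spanning_trees G arev = (\<lambda>F. G\<lparr>arcs := F\<rparr>) ` {F. tree_on (verts G) F}"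
proof (intro Set.set_eqI iffI)
  fix H assume "H \<in> undirected_spanning_trees G arev"
  then have H: "subgraph H G" "verts H = verts G" "arev ` arcs H \<subseteq> arcs H" 
    "connected H" "\<nexists>p. undirected_cycle H arev p"
    by (auto simp: undirected_spanning_trees_def spanning_def)
  define F where "F = arcs H"
  have eq: "H = G\<lparr>arcs := F\<rparr>" and sub: "F \<subseteq> arcs G" "arev ` F \<subseteq> F"
    using H(1-3) by (auto simp: F_def subgraph_def compatible_def intro!: pre_digraph.equality)
  have "walk_connected F (verts G)"
    using H(4) connected_restrict_iff[OF sub] unfolding eq by simp
  moreover have "cycle_free F"
    using H(5) undirected_cycle_restrict[OF sub(1)] unfolding cycle_free_def eq by simp
  ultimately have "tree_on (verts G) F"
    using sub by (auto simp: tree_on_def)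
  then show "H \<in> (\<lambda>F. G\<lparr>arcs := F\<rparr>) ` {F. tree_on (verts G) F}"
    using eq by blast
next
  fix H assume "H \<in> (\<lambda>F. G\<lparr>arcs := F\<rparr>) ` {F. tree_on (verts G) F}"
  then obtain F where F: "tree_on (verts G) F" "H = G\<lparr>arcs := F\<rparr>" by blast
  then have sub: "F \<subseteq> arcs G" "arev ` F \<subseteq> F" by (auto simp: tree_on_def)
  show "H \<in> undirected_spanning_trees G arev"
    using F assms sub connected_restrict_iff[OF sub] wf_restrict[OF sub(1)] wf_digraph_axioms
    by (auto simp: undirected_spanning_trees_def spanning_def subgraph_def compatible_def
        tree_on_def cycle_free_def undirected_cycle_restrict)
qed

lemma card_undirected_spanning_trees:
  assumes "verts G \<noteq> {}"
  shows "card (undirected_spanning_trees G arev) = card {F. tree_on (verts G) F}"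
  unfolding undirected_spanning_trees_eq[OF assms]
  by (intro card_image inj_on_inverseI[of _ arcs]) simp

lemma arev_closed_remove:
  assumes "arev ` U \<subseteq> U"
  shows "arev ` (U - {e, arev e}) \<subseteq> U - {e, arev e}"
proof
  fix b assume "b \<in> arev ` (U - {e, arev e})"
  then obtain a where a: "a \<in> U" "a \<noteq> e" "a \<noteq> arev e" "b = arev a" by auto
  then have "arev a \<in> U" using assms by blast
  moreover have "arev a \<noteq> e" using a(3) arev_arev by metis
  ultimately show "b \<in> U - {e, arev e}" using a by (simp add: arev_eq_iff)
qed

section \<open>Growing a tree\<close>

text \<open>
  Traversing an edge back would return to a vertex that the path has already visited.
\<close>

lemma apath_no_backtrack:
  assumes "apath u p v" "e \<in> set p"
  shows "arev e \<notin> set p"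
  using assms
proof (induction p arbitrary: u)
  case (Cons a p)
  then have a: "a \<in> arcs G" "apath (head G a) p v" "tail G a \<notin> set (awalk_verts (head G a) p)"
    by (auto simp: apath_Cons_iff)
  have "arev a \<notin> set p"
  proof
    assume "arev a \<in> set p"
    then have "head G (arev a) \<in> set (awalk_verts (head G a) p)"
      using a(2) awalk_verts_arc2 unfolding apath_def by blast
    then show False using a by simp
  qed
  then show ?case
    using Cons a arev_neq[of a] by (auto simp: arev_eq_iff)
qed simp

text \<open>
  Close the tree path between the ends of the new arc. A loop is covered by the empty path.
\<close>

lemma tree_plus_arc_has_cycle:
  assumes "tree_on S F" "e \<in> arcs G - F" "tail G e \<in> S" "head G e \<in> S"
    and H: "F \<subseteq> H" "e \<in> H" "arev ` F \<subseteq> F"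
  shows "\<not> cycle_free H"
proof -
  obtain p where p: "awalk (head G e) p (tail G e)" "set p \<subseteq> F"
    using assms unfolding tree_on_def walk_connected_def by metis
  define q where "q = awalk_to_apath p"
  have q: "apath (head G e) q (tail G e)" "set q \<subseteq> F"
    using apath_awalk_to_apath[OF p(1)] awalk_to_apath_subset[OF p(1)] p(2)
    by (auto simp: q_def)
  have "arev e \<notin> F"
    using assms(2) H(3) arev_arev by (metis DiffD2 image_subset_iff)
  then have rev: "arev e \<notin> set q" "e \<notin> arev ` set q"
    using q(2) H(3) assms(2) by auto
  have "cycle (e # q)"
    using q assms(2) unfolding cycle_def apath_def
    by (intro exI[of _ "tail G e"]) (auto simp: awalk_Cons_iff)
  moreover have "\<forall>a \<in> set (e # q). arev a \<notin> set (e # q)"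
    using rev apath_no_backtrack[OF q(1)] arev_neq[of e] assms(2) by auto
  ultimately show ?thesis
    using q(2) H unfolding cycle_free_def undirected_cycle_def
    by (metis insert_subset list.simps(15) subset_trans)
qed

text \<open>
  The new vertex is a leaf: a closed walk that enters it must leave it by the reverse of the same arc,
  so an undirected cycle cannot touch it and would lie in the old tree.
\<close>

lemma tree_on_add_leaf:
  assumes T: "tree_on S F" and e: "e \<in> arcs G" "tail G e \<in> S" "head G e \<notin> S"
  shows "tree_on (insert (head G e) S) (F \<union> {e, arev e})" (is "tree_on ?S ?F")
proof -
  have T': "S \<subseteq> verts G" "F \<subseteq> arcs G" "arev ` F \<subseteq> F" "tail G ` F \<subseteq> S" "head G ` F \<subseteq> S"
    "walk_connected F S" "cycle_free F"
    using T by (auto simp: tree_on_def)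
  have hub: "\<exists>p. awalk (tail G e) p v \<and> set p \<subseteq> ?F" "\<exists>p. awalk v p (tail G e) \<and> set p \<subseteq> ?F"
    if "v \<in> ?S" for v
  proof -
    show "\<exists>p. awalk (tail G e) p v \<and> set p \<subseteq> ?F"
    proof (cases "v \<in> S")
      case True
      then show ?thesis using T'(6) e unfolding walk_connected_def by blast
    next
      case False
      then show ?thesis using that e by (intro exI[of _ "[e]"]) (auto simp: awalk_simps)
    qed
    show "\<exists>p. awalk v p (tail G e) \<and> set p \<subseteq> ?F"
    proof (cases "v \<in> S")
      case True
      then show ?thesis using T'(6) e unfolding walk_connected_def by blast
    next
      case False
      then show ?thesis using that e by (intro exI[of _ "[arev e]"]) (auto simp: awalk_simps)
    qed
  qed
  have "walk_connected ?F ?S"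
    unfolding walk_connected_def
  proof (intro ballI)
    fix u v assume "u \<in> ?S" "v \<in> ?S"
    then obtain p q where "awalk u p (tail G e)" "awalk (tail G e) q v" "set p \<subseteq> ?F" "set q \<subseteq> ?F"
      using hub by metis
    then show "\<exists>p. awalk u p v \<and> set p \<subseteq> ?F"
      by (intro exI[of _ "p @ q"]) auto
  qed
  moreover have "cycle_free ?F"
    unfolding cycle_free_def
  proof
    assume "\<exists>p. undirected_cycle G arev p \<and> set p \<subseteq> ?F"
    then obtain p u where p: "awalk u p u" "\<forall>a \<in> set p. arev a \<notin> set p" "set p \<subseteq> ?F"
      and cyc: "undirected_cycle G arev p"
      by (auto simp: undirected_cycle_def cycle_def)
    note th = closed_walk_tails_heads[OF p(1)]
    \<comment> \<open>The new vertex has no other arcs, since the old ones end in \<open>S\<close>.\<close>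
    have only: "tail G a = head G e \<Longrightarrow> a = arev e" "head G a = head G e \<Longrightarrow> a = e" if "a \<in> ?F" for a
      using that T'(4,5) e by auto
    have "e \<in> set p \<longleftrightarrow> arev e \<in> set p"
    proof
      assume "e \<in> set p"
      then have "head G e \<in> tail G ` set p" using th by blast
      then obtain a where a: "a \<in> set p" "tail G a = head G e" by auto
      then have "a = arev e" using only(1) p(3) by blast
      then show "arev e \<in> set p" using a by simp
    next
      assume "arev e \<in> set p"
      then have "tail G (arev e) \<in> head G ` set p" using th by blast
      then obtain a where a: "a \<in> set p" "head G a = head G e" using e by auto
      then have "a = e" using only(2) p(3) by blast
      then show "e \<in> set p" using a by simp
    qed
    then have "set p \<subseteq> F" using p(2,3) by auto
    then show False using T'(7) cyc by (auto simp: cycle_free_def)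
  qed
  ultimately show ?thesis
    using T' e by (auto simp: tree_on_def)
qed

section \<open>Counting spanning trees by parking functions\<close>

lemma parkingD:
  assumes "f \<in> parking S U" "A \<noteq> {}" "A \<subseteq> verts G - S"
  obtains v where "v \<in> A" "f v < card {e \<in> U. tail G e = v \<and> head G e \<notin> A}"
proof -
  have "\<exists>v \<in> A. f v < card {e \<in> U. tail G e = v \<and> head G e \<notin> A}"
    using assms by (simp add: parking_def)
  then show thesis using that by blast
qed

text \<open>
  Pick an arc \<open>e\<close> of \<open>U\<close> from \<open>S\<close> to a new vertex \<open>v\<close>. Trees containing \<open>e\<close> extend \<open>F\<close> plus \<open>e\<close>; the
  others avoid \<open>e\<close>. Parking functions with value \<open>0\<close> at \<open>v\<close> are those for which the fire burning
  along \<open>e\<close> consumes \<open>v\<close>, i.e. the parking functions for the enlarged \<open>S\<close>; the others become parking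
  functions for \<open>U\<close> without \<open>e\<close> after losing one chip at \<open>v\<close>. Both sides therefore satisfy the
  same recursion. When no such arc is left, both counts are \<open>1\<close> or \<open>0\<close> according to
  whether \<open>S\<close> is everything.
\<close>

theorem card_parking_eq_card_tree_extensions:
  assumes "tree_on S F" "S \<noteq> {}" "U \<subseteq> arcs G" "arev ` U \<subseteq> U" "F \<inter> U = {}"
  shows "finite (parking S U) \<and> card (parking S U) = card (tree_extensions F U)"
  using assms
proof (induction "card U" arbitrary: S F U rule: less_induct)
  case less
  have T: "S \<subseteq> verts G" "F \<subseteq> arcs G" "arev ` F \<subseteq> F" "tail G ` F \<subseteq> S" "head G ` F \<subseteq> S"
    using less.prems(1) by (auto simp: tree_on_def)
  have finU: "finite U" using less.prems(3) by (rule finite_subset) simp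
  show ?case
  proof (cases "\<exists>e \<in> U. tail G e \<in> S \<and> head G e \<notin> S")
    case False
    have no_in: False if "e \<in> U" "tail G e \<notin> S" "head G e \<in> S" for e
    proof -
      have "arev e \<in> U" "e \<in> arcs G" using that less.prems by auto
      then show False using False that by fastforce
    qed
    show ?thesis
    proof (cases "S = verts G")
      case True
      have "parking S U = {\<lambda>_. 0}"
        unfolding parking_def True by auto
      moreover have "tree_extensions F U = {F}"
      proof -
        have "H = F" if "H \<in> tree_extensions F U" for H
        proof (rule ccontr)
          assume "H \<noteq> F"
          moreover have H: "F \<subseteq> H" "H \<subseteq> arcs G" "cycle_free H"
            using that by (auto simp: tree_extensions_def tree_on_def)
          ultimately obtain e where "e \<in> H" "e \<notin> F" by blast
          then show False using H
            using tree_plus_arc_has_cycle[OF less.prems(1), of e H] T True by auto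
        qed
        moreover have "F \<in> tree_extensions F U"
          using less.prems True by (auto simp: tree_extensions_def)
        ultimately show ?thesis by auto
      qed
      ultimately show ?thesis by simp
    next
      case ne: False
      have "parking S U = {}"
      proof -
        have *: "{e \<in> U. tail G e = v \<and> head G e \<notin> verts G - S} = {}" if "v \<in> verts G - S" for v
          using that no_in less.prems by auto
        have nonempty: "verts G - S \<noteq> {}" using ne T by auto
        have "f \<notin> parking S U" for f
        proof
          assume "f \<in> parking S U"
          then obtain v where v: "v \<in> verts G - S"
            "f v < card {e \<in> U. tail G e = v \<and> head G e \<notin> verts G - S}"
            using nonempty parkingD[of f S U "verts G - S" thesis] by simp
          show False using v(2) unfolding *[OF v(1)] by simp
        qed
        then show ?thesis by blast
      qed
      moreover have "tree_extensions F U = {}"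
      proof -
        have False if H: "H \<in> tree_extensions F U" for H
        proof -
          obtain u v where "u \<in> S" "v \<in> verts G - S" using ne T less.prems(2) by auto
          moreover have "walk_connected H (verts G)"
            using H by (simp add: tree_extensions_def tree_on_def)
          then obtain p where "awalk u p v" "set p \<subseteq> H"
            using calculation T(1) unfolding walk_connected_def by blast
          ultimately obtain e where "e \<in> H" "tail G e \<in> S" "head G e \<notin> S"
            using walk_crosses_cut[of u p v S] by auto
          moreover from this have "e \<in> F \<or> e \<in> U" using H by (auto simp: tree_extensions_def)
          ultimately show False using False T(5) by blast
        qed
        then show ?thesis by auto
      qed
      ultimately show ?thesis by simp
    qed
  next
    case True
    then obtain e where e: "e \<in> U" "tail G e \<in> S" "head G e \<notin> S" by blast
    define v where "v = head G e"
    define U' where "U' = U - {e, arev e}"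
    define F' where "F' = F \<union> {e, arev e}"
    have eG: "e \<in> arcs G" "arev e \<in> U" "e \<noteq> arev e" "v \<in> verts G"
      using e less.prems arev_neq[of e] by (auto simp: v_def)
    have eF: "e \<notin> F" using e less.prems by auto
    have "arev ` U' \<subseteq> U'"
      unfolding U'_def by (rule arev_closed_remove) (rule less.prems(4))
    moreover have "card U' < card U"
      using e(1) finU by (intro psubset_card_mono) (auto simp: U'_def)
    ultimately have U': "card U' < card U" "U' \<subseteq> arcs G" "arev ` U' \<subseteq> U'" "F \<inter> U' = {}" "F' \<inter> U' = {}"
      using less.prems by (auto simp: U'_def F'_def)
    have IH1: "finite (parking (insert v S) U')"
      "card (parking (insert v S) U') = card (tree_extensions F' U')"
      using less.hyps[OF U'(1) tree_on_add_leaf[OF less.prems(1) eG(1) e(2,3)] _ U'(2,3)] U'(5)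
      by (auto simp: v_def F'_def)
    have IH2: "finite (parking S U')" "card (parking S U') = card (tree_extensions F U')"
      using less.hyps[OF U'(1) less.prems(1,2) U'(2,3,4)] by auto
    have trees: "tree_extensions F U = tree_extensions F' U' \<union> tree_extensions F U'"
    proof (intro Set.set_eqI iffI)
      fix H assume H: "H \<in> tree_extensions F U"
      then have "arev ` H \<subseteq> H" by (simp add: tree_extensions_def tree_on_def)
      then have "e \<in> H \<longleftrightarrow> arev e \<in> H" using arev_arev[of e] image_subset_iff by metis
      then show "H \<in> tree_extensions F' U' \<union> tree_extensions F U'"
        using H by (auto simp: tree_extensions_def F'_def U'_def)
    qed (use e eG in \<open>auto simp: tree_extensions_def F'_def U'_def\<close>)
    have trees_disj: "tree_extensions F' U' \<inter> tree_extensions F U' = {}"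
      using eF by (auto simp: tree_extensions_def F'_def U'_def)
    have trees_fin: "finite (tree_extensions X Y)" for X Y
      by (rule finite_subset[of _ "Pow (arcs G)"]) (auto simp: tree_extensions_def tree_on_def)
    \<comment> \<open>The reverse of \<open>e\<close> is the one arc outside \<open>U'\<close> that leaves a set disjoint from \<open>S\<close>; it starts at \<open>v\<close>.\<close>
    have out_other: "{a \<in> U. tail G a = w \<and> head G a \<notin> A} = {a \<in> U'. tail G a = w \<and> head G a \<notin> A}"
      if "A \<subseteq> verts G - S" "w \<in> A" "w \<noteq> v" for A w
      using that e eG by (auto simp: U'_def v_def)
    have out_v: "card {a \<in> U. tail G a = v \<and> head G a \<notin> A} =
        Suc (card {a \<in> U'. tail G a = v \<and> head G a \<notin> A})"
      if "A \<subseteq> verts G - S" for A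
    proof -
      have "{a \<in> U. tail G a = v \<and> head G a \<notin> A} =
          insert (arev e) {a \<in> U'. tail G a = v \<and> head G a \<notin> A}"
        using that e eG by (auto simp: U'_def v_def)
      moreover have "arev e \<notin> U'" by (simp add: U'_def)
      ultimately show ?thesis using finU by (simp add: U'_def)
    qed
    have zero: "{f \<in> parking S U. f v = 0} = parking (insert v S) U'"
    proof (intro Set.set_eqI iffI)
      fix f assume f: "f \<in> {f \<in> parking S U. f v = 0}"
      show "f \<in> parking (insert v S) U'"
        unfolding parking_def
      proof (intro CollectI conjI allI impI)
        fix w assume "w \<notin> verts G - insert v S"
        then show "f w = 0" using f by (auto simp: parking_def)
      next
        fix A assume A: "A \<noteq> {}" "A \<subseteq> verts G - insert v S"
        then obtain w where w: "w \<in> A" "f w < card {a \<in> U. tail G a = w \<and> head G a \<notin> A}"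
          using parkingD[of f S U A] f by blast
        moreover have "A \<subseteq> verts G - S" "w \<noteq> v" using A(2) w(1) by auto
        ultimately show "\<exists>w\<in>A. f w < card {a \<in> U'. tail G a = w \<and> head G a \<notin> A}"
          unfolding out_other[OF \<open>A \<subseteq> verts G - S\<close> w(1) \<open>w \<noteq> v\<close>] by blast
      qed
    next
      fix f assume f: "f \<in> parking (insert v S) U'"
      then have fv: "f v = 0" by (auto simp: parking_def)
      have "f \<in> parking S U"
        unfolding parking_def
      proof (intro CollectI conjI allI impI)
        fix w assume "w \<notin> verts G - S"
        then show "f w = 0" using f by (auto simp: parking_def)
      next
        fix A assume A: "A \<noteq> {}" "A \<subseteq> verts G - S"
        show "\<exists>w\<in>A. f w < card {a \<in> U. tail G a = w \<and> head G a \<notin> A}"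
        proof (cases "v \<in> A")
          case True
          then show ?thesis using fv out_v[OF A(2)] by (intro bexI[of _ v]) auto
        next
          case False
          then have "A \<subseteq> verts G - insert v S" using A by auto
          then obtain w where w: "w \<in> A" "f w < card {a \<in> U'. tail G a = w \<and> head G a \<notin> A}"
            using parkingD[OF f A(1)] by blast
          moreover have "w \<noteq> v" using w(1) False by blast
          ultimately show ?thesis
            unfolding out_other[OF A(2) w(1) \<open>w \<noteq> v\<close>, symmetric] by blast
        qed
      qed
      then show "f \<in> {f \<in> parking S U. f v = 0}" using fv by simp
    qed
    have shift: "f(v := Suc (f v)) \<in> parking S U \<longleftrightarrow> f \<in> parking S U'" for f
    proof -
      have bex: "(\<exists>w\<in>A. (f(v := Suc (f v))) w < card {a \<in> U. tail G a = w \<and> head G a \<notin> A}) \<longleftrightarrow>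
        (\<exists>w\<in>A. f w < card {a \<in> U'. tail G a = w \<and> head G a \<notin> A})"
        if "A \<subseteq> verts G - S" for A
        by (rule bex_cong) (use that out_v[OF that] out_other[OF that] in auto)
      have "v \<in> verts G - S" using e eG v_def by auto
      then have supp: "(\<forall>w. w \<notin> verts G - S \<longrightarrow> (f(v := Suc (f v))) w = 0) \<longleftrightarrow>
          (\<forall>w. w \<notin> verts G - S \<longrightarrow> f w = 0)"
        by auto
      show ?thesis
        by (simp only: parking_def mem_Collect_eq supp bex cong: imp_cong)
    qed
    have pos: "{f \<in> parking S U. f v \<noteq> 0} = (\<lambda>f. f(v := Suc (f v))) ` parking S U'"
    proof (intro Set.set_eqI iffI)
      fix f assume f: "f \<in> {f \<in> parking S U. f v \<noteq> 0}"
      define g where "g = f(v := f v - 1)"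
      have "f = g(v := Suc (g v))" using f by (auto simp: g_def)
      then show "f \<in> (\<lambda>f. f(v := Suc (f v))) ` parking S U'"
        using shift[of g] f by auto
    qed (auto simp: shift)
    have inj: "inj_on (\<lambda>f. f(v := Suc (f v))) (parking S U')"
    proof (rule inj_onI)
      fix f g :: "'v \<Rightarrow> nat" assume *: "f(v := Suc (f v)) = g(v := Suc (g v))"
      show "f = g"
      proof
        fix w show "f w = g w" using fun_cong[OF *, of w] by (auto split: if_splits)
      qed
    qed
    have split: "parking S U = parking (insert v S) U' \<union> (\<lambda>f. f(v := Suc (f v))) ` parking S U'"
      unfolding zero[symmetric] pos[symmetric] by auto
    have disj: "parking (insert v S) U' \<inter> (\<lambda>f. f(v := Suc (f v))) ` parking S U' = {}"
      unfolding zero[symmetric] pos[symmetric] by auto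
    have "card (parking S U) = card (parking (insert v S) U') + card (parking S U')"
      unfolding split using IH1 IH2 disj card_image[OF inj] by (subst card_Un_disjoint) auto
    moreover have "finite (parking S U)"
      unfolding split using IH1 IH2 by simp
    moreover have "card (tree_extensions F U) = card (tree_extensions F' U') + card (tree_extensions F U')"
      unfolding trees using trees_disj trees_fin by (intro card_Un_disjoint) auto
    ultimately show ?thesis
      using IH1 IH2 by simp
  qed
qed

corollary card_parking_eq_card_spanning_trees:
  assumes "q \<in> verts G"
  shows "finite (parking {q} (arcs G))"
    "card (parking {q} (arcs G)) = card (undirected_spanning_trees G arev)"
proof -
  have "tree_on {q} {}"
    using assms by (auto simp: tree_on_def walk_connected_def cycle_free_def undirected_cycle_def
        cycle_def awalk_Nil_iff intro!: exI[of _ "[]"])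
  then have *: "finite (parking {q} (arcs G)) \<and>
      card (parking {q} (arcs G)) = card (tree_extensions {} (arcs G))"
    by (rule card_parking_eq_card_tree_extensions) auto
  have "tree_extensions {} (arcs G) = {F. tree_on (verts G) F}"
    by (auto simp: tree_extensions_def tree_on_def)
  then show "finite (parking {q} (arcs G))"
    "card (parking {q} (arcs G)) = card (undirected_spanning_trees G arev)"
    using * card_undirected_spanning_trees assms by force+
qed

end

section \<open>The Laplacian\<close>

locale rooted_multigraph = multigraph G arev
  for G :: "('v, 'e) pre_digraph" and arev +
  fixes q :: 'v
  assumes connected: "Digraph_Component.connected G" and root: "q \<in> verts G"
begin

definition laplacian :: "('v \<Rightarrow> int) \<Rightarrow> 'v \<Rightarrow> int" where
  "laplacian h v = (\<Sum>e \<in> out_arcs G v. h (tail G e) - h (head G e))"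

lemma walk_exists:
  assumes "u \<in> verts G" "v \<in> verts G"
  obtains p where "awalk u p v"
proof -
  have "walk_connected (arcs G) (verts G)"
    using connected connected_restrict_iff[of "arcs G"] by (simp add: image_subset_iff)
  then show ?thesis using assms that unfolding walk_connected_def by blast
qed

lemma laplacian_add: "laplacian (\<lambda>v. h v + k v) v = laplacian h v + laplacian k v"
  by (simp add: laplacian_def sum.distrib[symmetric] algebra_simps)

lemma laplacian_mult: "laplacian (\<lambda>v. c * h v) v = c * laplacian h v"
  by (simp add: laplacian_def sum_distrib_left algebra_simps)

lemma laplacian_uminus: "laplacian (\<lambda>v. - h v) v = - laplacian h v"
  using laplacian_mult[of "-1" h v] by simp

lemma laplacian_diff: "laplacian (\<lambda>v. h v - k v) v = laplacian h v - laplacian k v"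
  using laplacian_add[of h "\<lambda>v. - k v" v] laplacian_uminus[of k v] by simp

lemma laplacian_const:
  assumes "\<And>w. w \<in> verts G \<Longrightarrow> h w = c"
  shows "laplacian h v = 0"
  unfolding laplacian_def by (rule sum.neutral) (auto simp: assms)

text \<open>
  All terms of the Laplacian are nonnegative at a maximum, and an arc leaving the set of maxima
  contributes at least \<open>1\<close> because the values are integers.
\<close>

lemma laplacian_at_maximum:
  assumes max: "\<And>w. w \<in> verts G \<Longrightarrow> h w \<le> m"
    and A: "A = {w \<in> verts G. h w = m}" and v: "v \<in> A"
  shows "int (card {e \<in> arcs G. tail G e = v \<and> head G e \<notin> A}) \<le> laplacian h v"
proof -
  have eq: "{e \<in> arcs G. tail G e = v \<and> head G e \<notin> A} = {e \<in> out_arcs G v. head G e \<notin> A}"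
    by auto
  have "int (card {e \<in> out_arcs G v. head G e \<notin> A}) = (\<Sum>e \<in> out_arcs G v. if head G e \<notin> A then 1 else 0)"
    by (subst sum.inter_filter[symmetric]) auto
  also have "\<dots> \<le> laplacian h v"
    unfolding laplacian_def
  proof (rule sum_mono)
    fix e assume e: "e \<in> out_arcs G v"
    then have "h (head G e) \<le> m" "head G e \<in> verts G" "h (tail G e) = m"
      using max v A by auto
    then show "(if head G e \<notin> A then 1 else 0) \<le> h (tail G e) - h (head G e)"
      using A by auto
  qed
  finally show ?thesis unfolding eq .
qed

lemma laplacian_indicator:
  "v \<in> A \<Longrightarrow> laplacian (\<lambda>w. of_bool (w \<in> A)) v = int (card {e \<in> arcs G. tail G e = v \<and> head G e \<notin> A})"
  "v \<notin> A \<Longrightarrow> laplacian (\<lambda>w. of_bool (w \<in> A)) v \<le> 0"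
proof -
  assume v: "v \<in> A"
  have eq: "{e \<in> arcs G. tail G e = v \<and> head G e \<notin> A} = {e \<in> out_arcs G v. head G e \<notin> A}"
    by auto
  have "int (card {e \<in> out_arcs G v. head G e \<notin> A}) = (\<Sum>e \<in> out_arcs G v. if head G e \<notin> A then 1 else 0)"
    by (subst sum.inter_filter[symmetric]) auto
  also have "\<dots> = laplacian (\<lambda>w. of_bool (w \<in> A)) v"
    unfolding laplacian_def by (rule sum.cong) (use v in auto)
  finally show "laplacian (\<lambda>w. of_bool (w \<in> A)) v = int (card {e \<in> arcs G. tail G e = v \<and> head G e \<notin> A})"
    unfolding eq by simp
next
  assume "v \<notin> A"
  then show "laplacian (\<lambda>w. of_bool (w \<in> A)) v \<le> 0"
    unfolding laplacian_def by (intro sum_nonpos) auto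
qed

section \<open>Parking functions represent the cokernel of the Laplacian\<close>

text \<open>
  If the maximum of \<open>h\<close> were missed by \<open>q\<close>, the set of maxima would be a set to which the parking
  condition applies, and \<open>g\<close> would be negative at the vertex that this condition provides.
\<close>

lemma parking_difference_max_at_root:
  assumes f: "f \<in> parking {q} (arcs G)"
    and eq: "\<And>v. v \<in> verts G - {q} \<Longrightarrow> int (f v) - int (g v) = laplacian h v"
    and v: "v \<in> verts G"
  shows "h v \<le> h q"
proof -
  define m where "m = Max (h ` verts G)"
  define A where "A = {w \<in> verts G. h w = m}"
  have le: "h w \<le> m" if "w \<in> verts G" for w
    using that by (simp add: m_def)
  have "m \<in> h ` verts G" using root unfolding m_def by (intro Max_in) auto
  then have "A \<noteq> {}" by (auto simp: A_def)
  have "q \<in> A"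
  proof (rule ccontr)
    assume "q \<notin> A"
    then have sub: "A \<subseteq> verts G - {q}" by (auto simp: A_def)
    obtain w where w: "w \<in> A" "f w < card {e \<in> arcs G. tail G e = w \<and> head G e \<notin> A}"
      using parkingD[OF f \<open>A \<noteq> {}\<close> sub] .
    have "int (card {e \<in> arcs G. tail G e = w \<and> head G e \<notin> A}) \<le> laplacian h w"
      by (rule laplacian_at_maximum[OF le A_def w(1)])
    moreover have "int (f w) - int (g w) = laplacian h w" using eq w(1) sub by blast
    ultimately show False using w(2) by linarith
  qed
  then show ?thesis using le[OF v] by (simp add: A_def)
qed

text \<open>
  By the maximum principle applied to \<open>h\<close> and to \<open>- h\<close>, the potential is constant.
\<close>

theorem parking_representative_unique:
  assumes f: "f \<in> parking {q} (arcs G)" and g: "g \<in> parking {q} (arcs G)"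
    and eq: "\<And>v. v \<in> verts G - {q} \<Longrightarrow> int (f v) - int (g v) = laplacian h v"
  shows "f = g"
proof
  fix v
  have "h w \<le> h q" if "w \<in> verts G" for w
    using parking_difference_max_at_root[OF f eq that] .
  moreover have "- h w \<le> - h q" if "w \<in> verts G" for w
    using parking_difference_max_at_root[OF g, of f "\<lambda>v. - h v" w] eq that
    by (simp add: laplacian_uminus algebra_simps)
  ultimately have "laplacian h v = 0"
    by (intro laplacian_const[of h "h q"]) force
  then show "f v = g v"
  proof (cases "v \<in> verts G - {q}")
    case True
    then show ?thesis using eq[OF True] \<open>laplacian h v = 0\<close> by simp
  next
    case False
    then show ?thesis using f g by (simp add: parking_def)
  qed
qed

text \<open>The distance to \<open>q\<close>.\<close>

lemma rank_towards_root:
  obtains r :: "'v \<Rightarrow> nat" where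
    "\<And>v. v \<in> verts G - {q} \<Longrightarrow> \<exists>e \<in> arcs G. tail G e = v \<and> r (head G e) < r v"
proof -
  define r where "r v = (LEAST n. \<exists>p. awalk v p q \<and> length p = n)" for v
  have "\<exists>e \<in> arcs G. tail G e = v \<and> r (head G e) < r v" if v: "v \<in> verts G - {q}" for v
  proof -
    obtain p0 where "awalk v p0 q" using walk_exists[of v q] v root by blast
    then have "\<exists>n p. awalk v p q \<and> length p = n" by blast
    then have "\<exists>p. awalk v p q \<and> length p = r v"
      unfolding r_def by (rule LeastI_ex)
    then obtain p where p: "awalk v p q" "length p = r v" by blast
    have "p \<noteq> []" using p(1) v by (auto simp: awalk_Nil_iff)
    then obtain e p' where e: "p = e # p'" by (cases p) auto
    have "awalk (head G e) p' q" "e \<in> arcs G" "tail G e = v"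
      using p(1) e by (auto simp: awalk_Cons_iff)
    moreover from this have "r (head G e) \<le> length p'"
      unfolding r_def by (intro Least_le) blast
    ultimately show ?thesis using e p(2) by (intro bexI[of _ e]) auto
  qed
  then show ?thesis using that by blast
qed

text \<open>
  A function of the rank whose increments decrease so fast that the one guaranteed step to a lower rank
  outweighs all the others.
\<close>

lemma positive_laplacian:
  obtains u :: "'v \<Rightarrow> int" where "\<And>v. v \<in> verts G - {q} \<Longrightarrow> 1 \<le> laplacian u v"
proof -
  obtain r :: "'v \<Rightarrow> nat" where
    r: "\<And>v. v \<in> verts G - {q} \<Longrightarrow> \<exists>e \<in> arcs G. tail G e = v \<and> r (head G e) < r v"
    by (rule rank_towards_root) blast
  define n where "n = Max (r ` verts G)"
  \<comment> \<open>The base exceeds the number of arcs at any vertex, so that one large term beats all the others.\<close>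
  define M where "M = int (card (arcs G)) + 2"
  define u where "u v = - (M ^ (n - r v))" for v
  have "1 \<le> laplacian u v" if v: "v \<in> verts G - {q}" for v
  proof -
    define K where "K = M ^ (n - r v)"
    have K: "1 \<le> K" by (simp add: K_def M_def one_le_power)
    obtain e0 where e0: "e0 \<in> out_arcs G v" "r (head G e0) < r v" using r[OF v] by auto
    have "r v \<le> n" unfolding n_def using v by (intro Max_ge) auto
    then have "Suc (n - r v) \<le> n - r (head G e0)" using e0(2) by linarith
    then have "M ^ Suc (n - r v) \<le> M ^ (n - r (head G e0))"
      by (intro power_increasing) (auto simp: M_def)
    then have first: "(M - 1) * K \<le> u (tail G e0) - u (head G e0)"
      using e0(1) by (simp add: u_def K_def algebra_simps)
    have "- K \<le> u (tail G e) - u (head G e)" if "e \<in> out_arcs G v - {e0}" for e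
      using that by (simp add: u_def K_def M_def)
    then have "(\<Sum>e \<in> out_arcs G v - {e0}. - K) \<le> (\<Sum>e \<in> out_arcs G v - {e0}. u (tail G e) - u (head G e))"
      by (rule sum_mono)
    then have rest: "- (int (card (out_arcs G v - {e0})) * K) \<le>
        (\<Sum>e \<in> out_arcs G v - {e0}. u (tail G e) - u (head G e))"
      by simp
    have "card (out_arcs G v - {e0}) \<le> card (arcs G)"
      by (intro card_mono) auto
    then have "int (card (out_arcs G v - {e0})) \<le> M - 2"
      by (simp add: M_def)
    then have "int (card (out_arcs G v - {e0})) * K \<le> (M - 2) * K"
      using K by (intro mult_right_mono) auto
    moreover have "laplacian u v = (u (tail G e0) - u (head G e0)) +
        (\<Sum>e \<in> out_arcs G v - {e0}. u (tail G e) - u (head G e))"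
      unfolding laplacian_def using e0(1) by (intro sum.remove) auto
    moreover have "(M - 1) * K - (M - 2) * K = K" by (simp add: algebra_simps)
    ultimately show ?thesis using first rest K by linarith
  qed
  then show ?thesis using that by blast
qed

text \<open>The Laplacian is nonpositive at a minimum.\<close>

lemma superharmonic_min_at_root:
  assumes "\<And>v. v \<in> verts G - {q} \<Longrightarrow> 0 < laplacian k v" and v: "v \<in> verts G"
  shows "k q \<le> k v"
proof -
  define m where "m = Min (k ` verts G)"
  have le: "m \<le> k w" if "w \<in> verts G" for w
    using that by (simp add: m_def)
  have "m \<in> k ` verts G" using root unfolding m_def by (intro Min_in) auto
  then obtain w where w: "w \<in> verts G" "k w = m" by blast
  have "laplacian k w \<le> 0"
    unfolding laplacian_def by (rule sum_nonpos) (use w le in auto)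
  then have "w = q" using assms(1)[of w] w(1) by force
  then show ?thesis using w le[OF v] by simp
qed

text \<open>
  Call a potential normalised to \<open>0\<close> at \<open>q\<close> feasible if it makes the function nonnegative off \<open>q\<close>. A
  multiple of a potential with positive Laplacian is feasible, and the minimum principle
  bounds feasible potentials from below; so one with least total exists. It yields a parking
  function: a set that violated the parking condition could be fired, and subtracting its indicator
  would give a feasible potential with smaller total.
\<close>

theorem parking_representative_exists:
  fixes D :: "'v \<Rightarrow> int"
  obtains h f where "f \<in> parking {q} (arcs G)"
    "\<And>v. v \<in> verts G - {q} \<Longrightarrow> int (f v) = D v + laplacian h v"
proof -
  obtain u0 :: "'v \<Rightarrow> int" where u0: "\<And>v. v \<in> verts G - {q} \<Longrightarrow> 1 \<le> laplacian u0 v"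
    by (rule positive_laplacian) blast
  define u where "u v = u0 v - u0 q" for v
  have u: "1 \<le> laplacian u v" if "v \<in> verts G - {q}" for v
  proof -
    have "laplacian u v = laplacian u0 v - laplacian (\<lambda>_. u0 q) v"
      unfolding u_def by (rule laplacian_diff)
    also have "laplacian (\<lambda>_. u0 q) v = 0" by (rule laplacian_const) simp
    finally show ?thesis using u0[OF that] by simp
  qed
  define N where "N = (\<Sum>v \<in> verts G. \<bar>D v\<bar>)"
  have N: "\<bar>D v\<bar> \<le> N" if "v \<in> verts G" for v
    unfolding N_def using that by (intro member_le_sum) auto
  have "0 \<le> N" unfolding N_def by (rule sum_nonneg) simp
  define feasible where "feasible h \<longleftrightarrow> h q = 0 \<and> (\<forall>v \<in> verts G - {q}. 0 \<le> D v + laplacian h v)" for h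
  have feasible0: "feasible (\<lambda>v. N * u v)"
    unfolding feasible_def
  proof (intro conjI ballI)
    show "N * u q = 0" by (simp add: u_def)
    fix v assume v: "v \<in> verts G - {q}"
    have "N * 1 \<le> N * laplacian u v" using u[OF v] \<open>0 \<le> N\<close> by (rule mult_left_mono)
    then show "0 \<le> D v + laplacian (\<lambda>v. N * u v) v"
      unfolding laplacian_mult using N[of v] v by auto
  qed
  \<comment> \<open>\<open>N + 1\<close> instead of \<open>N\<close> makes the Laplacian strictly positive, as the minimum principle requires.\<close>
  have bound: "0 \<le> h v + (N + 1) * u v" if h: "feasible h" and v: "v \<in> verts G" for h v
  proof -
    have "0 < laplacian (\<lambda>v. h v + (N + 1) * u v) w" if w: "w \<in> verts G - {q}" for w
    proof -
      define X where "X = (N + 1) * laplacian u w"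
      have "(N + 1) * 1 \<le> X"
        unfolding X_def using u[OF w] \<open>0 \<le> N\<close> by (intro mult_left_mono) auto
      then have "N + 1 \<le> X" by simp
      moreover have "0 \<le> D w + laplacian h w" using h w by (simp add: feasible_def)
      moreover have "D w \<le> N" using N[of w] w by auto
      ultimately have "0 < laplacian h w + X" by linarith
      then show ?thesis by (simp only: laplacian_add laplacian_mult X_def)
    qed
    then have "h q + (N + 1) * u q \<le> h v + (N + 1) * u v"
      using superharmonic_min_at_root[of "\<lambda>v. h v + (N + 1) * u v" v] v by blast
    then show ?thesis using h by (simp add: feasible_def u_def)
  qed
  define size where "size h = nat (\<Sum>v \<in> verts G. h v + (N + 1) * u v)" for h
  obtain h where h: "feasible h" and min: "\<And>k. feasible k \<Longrightarrow> size h \<le> size k"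
    using ex_has_least_nat[of feasible "\<lambda>v. N * u v" size] feasible0 by blast
  define f where "f v = (if v \<in> verts G - {q} then nat (D v + laplacian h v) else 0)" for v
  have f: "int (f v) = D v + laplacian h v" if "v \<in> verts G - {q}" for v
    using that h by (simp add: f_def feasible_def)
  have "f \<in> parking {q} (arcs G)"
    unfolding parking_def
  proof (intro CollectI conjI allI impI)
    fix v assume "v \<notin> verts G - {q}"
    then show "f v = 0" unfolding f_def by (rule if_not_P)
  next
    fix A assume A: "A \<noteq> {}" "A \<subseteq> verts G - {q}"
    show "\<exists>v\<in>A. f v < card {e \<in> arcs G. tail G e = v \<and> head G e \<notin> A}"
    proof (rule ccontr)
      assume "\<not> ?thesis"
      then have legal: "card {e \<in> arcs G. tail G e = v \<and> head G e \<notin> A} \<le> f v" if "v \<in> A" for v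
        using that by force
      define k where "k v = h v - of_bool (v \<in> A)" for v
      have lap_k: "laplacian k v = laplacian h v - laplacian (\<lambda>v. of_bool (v \<in> A)) v" for v
        unfolding k_def by (rule laplacian_diff)
      have "feasible k"
        unfolding feasible_def
      proof (intro conjI ballI)
        show "k q = 0" using h A(2) by (auto simp: k_def feasible_def)
        fix v assume v: "v \<in> verts G - {q}"
        show "0 \<le> D v + laplacian k v"
        proof (cases "v \<in> A")
          case True
          then show ?thesis
            using legal[OF True] f[OF v] unfolding lap_k laplacian_indicator(1)[OF True] by linarith
        next
          case False
          then show ?thesis
            using laplacian_indicator(2)[OF False] h v unfolding lap_k feasible_def by force
        qed
      qed
      then have "size h \<le> size k" by (rule min)
      have "(\<Sum>v \<in> verts G. k v + (N + 1) * u v) < (\<Sum>v \<in> verts G. h v + (N + 1) * u v)"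
      proof (rule sum_strict_mono_ex1)
        show "\<exists>v\<in>verts G. k v + (N + 1) * u v < h v + (N + 1) * u v"
          using A by (auto simp: k_def)
      qed (auto simp: k_def)
      moreover have "0 \<le> (\<Sum>v \<in> verts G. k v + (N + 1) * u v)"
        using bound[OF \<open>feasible k\<close>] by (rule sum_nonneg)
      ultimately have "size k < size h" unfolding size_def by linarith
      then show False using \<open>size h \<le> size k\<close> by simp
    qed
  qed
  then show ?thesis using that f by blast
qed

text \<open>
  Pigeonhole on the parking representatives of the multiples of \<open>D\<close>: the cokernel of the reduced
  Laplacian is finite.
\<close>

lemma laplacian_multiple:
  fixes D :: "'v \<Rightarrow> int"
  obtains n :: nat and h where "0 < n" "\<And>v. v \<in> verts G - {q} \<Longrightarrow> int n * D v = laplacian h v"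
proof -
  have "\<exists>h f. f \<in> parking {q} (arcs G) \<and> (\<forall>v \<in> verts G - {q}. int (f v) = int k * D v + laplacian h v)"
    for k :: nat
    using parking_representative_exists[of "\<lambda>v. int k * D v"] by metis
  then obtain h f where f: "\<And>k :: nat. f k \<in> parking {q} (arcs G)"
    and h: "\<And>k v. v \<in> verts G - {q} \<Longrightarrow> int (f k v) = int k * D v + laplacian (h k) v"
    by metis
  have "finite (range f)"
    using f by (intro finite_subset[OF _ card_parking_eq_card_spanning_trees(1)[OF root]]) auto
  then have "\<not> inj f" using finite_imageD infinite_UNIV_nat by blast
  then obtain k l where kl: "k < l" "f k = f l"
    by (metis injI linorder_neqE_nat)
  have "int (l - k) * D v = laplacian (\<lambda>v. h k v - h l v) v" if "v \<in> verts G - {q}" for v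
    using h[OF that, of k] h[OF that, of l] kl
    by (simp add: laplacian_diff of_nat_diff left_diff_distrib)
  then show ?thesis using that[of "l - k"] kl(1) by simp
qed

section \<open>Bridgeless graphs\<close>

text \<open>
  Connectedness provides one arc across the cut, and connectedness after deleting its edge another.
\<close>

lemma bridgeless_cut:
  assumes bridgeless: "\<nexists>e. bridge G arev e"
    and A: "u \<in> A" "A \<subseteq> verts G" "v \<in> verts G" "v \<notin> A"
  obtains e e' where "e \<in> arcs G" "e' \<in> arcs G" "e \<noteq> e'"
    "tail G e \<in> A" "head G e \<notin> A" "tail G e' \<in> A" "head G e' \<notin> A"
proof -
  obtain p where p: "awalk u p v" using walk_exists[of u v] A by blast
  obtain e where e: "e \<in> set p" "tail G e \<in> A" "head G e \<notin> A"
    using walk_crosses_cut[OF p A(1,4)] by blast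
  have eG: "e \<in> arcs G" using p e(1) by (auto simp: awalk_def)
  define F where "F = arcs G - {e, arev e}"
  have "arev ` F \<subseteq> F"
    unfolding F_def by (rule arev_closed_remove) auto
  then have F: "F \<subseteq> arcs G" "arev ` F \<subseteq> F" by (auto simp: F_def)
  have "pre_digraph.del_arc (pre_digraph.del_arc G e) (arev e) = G\<lparr>arcs := F\<rparr>"
    by (intro pre_digraph.equality) (auto simp: pre_digraph.del_arc_def F_def)
  then have "Digraph_Component.connected (G\<lparr>arcs := F\<rparr>)"
    using bridgeless eG by (auto simp: bridge_def)
  then have "walk_connected F (verts G)"
    using connected_restrict_iff[OF F] by blast
  then obtain p' where p': "awalk u p' v" "set p' \<subseteq> F"
    using A unfolding walk_connected_def by blast
  obtain e' where e': "e' \<in> set p'" "tail G e' \<in> A" "head G e' \<notin> A"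
    using walk_crosses_cut[OF p'(1) A(1,4)] by blast
  then have "e' \<in> F" using p'(2) by blast
  then show ?thesis using that[of e e'] e e' eG by (auto simp: F_def)
qed

text \<open>
  Two distinct arcs leave the set of maxima of \<open>h\<close>. Only at \<open>x\<close> can the Laplacian be positive on that
  set, so both start at \<open>x\<close>, where it would have to be at least \<open>2\<close>.
\<close>

theorem bridgeless_vertices_inequivalent:
  assumes bridgeless: "\<nexists>e. bridge G arev e"
    and xy: "x \<in> verts G" "y \<in> verts G"
    and lap: "\<And>v. v \<in> verts G \<Longrightarrow> laplacian h v = of_bool (v = x) - of_bool (v = y)"
  shows "x = y"
proof (rule ccontr)
  assume "x \<noteq> y"
  define m where "m = Max (h ` verts G)"
  define A where "A = {w \<in> verts G. h w = m}"
  have le: "h w \<le> m" if "w \<in> verts G" for w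
    using that by (simp add: m_def)
  have "m \<in> h ` verts G" using root unfolding m_def by (intro Max_in) auto
  then obtain u where u: "u \<in> A" by (auto simp: A_def)
  have "\<exists>v \<in> verts G. v \<notin> A"
  proof (rule ccontr)
    assume "\<not> ?thesis"
    then have "laplacian h x = 0" by (intro laplacian_const[of h m]) (auto simp: A_def)
    then show False using lap[OF xy(1)] \<open>x \<noteq> y\<close> by simp
  qed
  then obtain v where v: "v \<in> verts G" "v \<notin> A" by blast
  obtain e e' where e: "e \<in> arcs G" "e' \<in> arcs G" "e \<noteq> e'"
    "tail G e \<in> A" "head G e \<notin> A" "tail G e' \<in> A" "head G e' \<notin> A"
    by (rule bridgeless_cut[OF bridgeless u _ v]) (auto simp: A_def)
  define out where "out w = {a \<in> arcs G. tail G a = w \<and> head G a \<notin> A}" for w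
  have out: "int (card (out w)) \<le> of_bool (w = x) - of_bool (w = y)" if "w \<in> A" for w
    using laplacian_at_maximum[OF le A_def that] lap[of w] that unfolding out_def A_def by simp
  have fin: "finite (out w)" for w by (simp add: out_def)
  have pos: "w = x" if "w \<in> A" "a \<in> out w" for w a
  proof -
    have "0 < card (out w)" using that(2) fin card_gt_0_iff by blast
    then show ?thesis using out[OF that(1)] by (cases "w = x"; cases "w = y") auto
  qed
  have "tail G e = x" "tail G e' = x"
    using e pos[of "tail G e" e] pos[of "tail G e'" e'] by (auto simp: out_def)
  then have "{e, e'} \<subseteq> out x" using e by (auto simp: out_def)
  then have "card {e, e'} \<le> card (out x)" by (rule card_mono[OF fin])
  then have "2 \<le> card (out x)" using e(3) by simp
  moreover have "x \<in> A" using e(4) \<open>tail G e = x\<close> by simp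
  ultimately show False using out[of x] \<open>x \<noteq> y\<close> by simp
qed

end

section \<open>Boundary and coboundary\<close>

context multigraph
begin

lemmas sum_edge_chain = sum_edge_chain[OF bidirected_digraph_axioms fin_digraph_axioms]
lemmas boundary_edge_chain = boundary_edge_chain[OF bidirected_digraph_axioms fin_digraph_axioms]
lemmas sum_scaled_edge_chain = sum_scaled_edge_chain[OF bidirected_digraph_axioms fin_digraph_axioms]
lemmas chains_presentation_generators =
  chains_presentation_generators[OF bidirected_digraph_axioms fin_digraph_axioms]

definition coboundary :: "('v \<Rightarrow> real) \<Rightarrow> 'e \<Rightarrow> real" where
  "coboundary h e = (if e \<in> arcs G then h (head G e) - h (tail G e) else 0)"

lemma sum_arev: "(\<Sum>e \<in> arcs G. g (arev e)) = (\<Sum>e \<in> arcs G. g e)"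
  using sum.permute[OF arev_permutes_arcs, of g] by (simp add: o_def)

lemma chains1_int_real: "c \<in> chains1 G arev \<int> \<Longrightarrow> c \<in> chains1 G arev \<real>"
  by (auto simp: chains1_def Reals_def)

lemma cycles_int_real: "z \<in> cycles G arev \<int> \<Longrightarrow> z \<in> cycles G arev \<real>"
  by (auto simp: cycles_def chains1_int_real)

lemma boundary_add: "boundary G (\<lambda>e. c e + d e) v = boundary G c v + boundary G d v"
  by (simp add: boundary_def distrib_right sum.distrib add_divide_distrib)

lemma boundary_diff: "boundary G (\<lambda>e. c e - d e) v = boundary G c v - boundary G d v"
  by (simp add: boundary_def left_diff_distrib sum_subtractf diff_divide_distrib)

lemma boundary_scale: "boundary G (\<lambda>e. a * c e) v = a * boundary G c v"
  by (simp add: boundary_def sum_distrib_left mult.assoc)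

lemma boundary_zero: "boundary G (\<lambda>_. 0) v = 0"
  by (simp add: boundary_def)

lemma boundary_sum: "boundary G (\<lambda>e. \<Sum>i \<in> I. c i e) v = (\<Sum>i \<in> I. boundary G (c i) v)"
  by (induction I rule: infinite_finite_induct) (simp_all add: boundary_zero boundary_add)

lemma total_boundary: "(\<Sum>v \<in> verts G. boundary G c v) = 0"
proof -
  have "(\<Sum>v \<in> verts G. boundary G c v) =
      (\<Sum>e \<in> arcs G. c e * (\<Sum>v \<in> verts G. of_bool (v = head G e) - of_bool (v = tail G e))) / 2"
    unfolding boundary_def sum_divide_distrib[symmetric] sum_distrib_left
    by (subst sum.swap) simp
  also have "(\<Sum>v \<in> verts G. of_bool (v = head G e) - of_bool (v = tail G e)) = (0 :: real)"
    if "e \<in> arcs G" for e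
    using that by (simp add: sum_subtractf of_bool_def)
  then have "(\<Sum>e \<in> arcs G. c e * (\<Sum>v \<in> verts G. of_bool (v = head G e) - of_bool (v = tail G e))) = 0"
    by (intro sum.neutral) simp
  finally show ?thesis by simp
qed

text \<open>
  The boundary of a chain has total \<open>0\<close>, so its value at one vertex is determined by the others.
\<close>

lemma boundary_zero_everywhere:
  assumes "q \<in> verts G" "\<And>v. v \<in> verts G - {q} \<Longrightarrow> boundary G c v = 0" "v \<in> verts G"
  shows "boundary G c v = 0"
proof -
  have "(\<Sum>v \<in> verts G. boundary G c v) = boundary G c q + (\<Sum>v \<in> verts G - {q}. boundary G c v)"
    using assms(1) by (intro sum.remove) auto
  also have "(\<Sum>v \<in> verts G - {q}. boundary G c v) = 0"
    by (rule sum.neutral) (use assms(2) in blast)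
  finally have "boundary G c q = 0" by (simp add: total_boundary)
  then show ?thesis using assms by (cases "v = q") auto
qed

text \<open>
  Antisymmetry makes the two orientations of an edge contribute equally, which absorbs the factor
  \<open>1/2\<close> and shows that integral chains have integral boundaries.
\<close>

lemma boundary_outgoing:
  assumes "c \<in> chains1 G arev \<real>"
  shows "boundary G c v = - (\<Sum>e \<in> out_arcs G v. c e)"
proof -
  have "(\<Sum>e \<in> arcs G. c e * of_bool (v = head G e)) = (\<Sum>e \<in> arcs G. c (arev e) * of_bool (v = head G (arev e)))"
    by (rule sum_arev[symmetric])
  also have "\<dots> = (\<Sum>e \<in> arcs G. - (c e * of_bool (v = tail G e)))"
    using assms by (intro sum.cong) (auto simp: chains1_def)
  finally have "boundary G c v = - (\<Sum>e \<in> arcs G. c e * of_bool (v = tail G e))"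
    by (simp add: boundary_def right_diff_distrib sum_subtractf sum_negf)
  also have "(\<Sum>e \<in> arcs G. c e * of_bool (v = tail G e)) = (\<Sum>e \<in> arcs G. if tail G e = v then c e else 0)"
    by (rule sum.cong) auto
  also have "\<dots> = (\<Sum>e \<in> out_arcs G v. c e)"
    unfolding out_arcs_def by (rule sum.inter_filter[symmetric]) simp
  finally show ?thesis .
qed

lemma boundary_integer:
  assumes "c \<in> chains1 G arev \<int>"
  shows "boundary G c v \<in> \<int>"
  unfolding boundary_outgoing[OF chains1_int_real[OF assms]]
  using assms by (intro Ints_minus Ints_sum) (auto simp: chains1_def)

lemma real_in_Reals: "(x :: real) \<in> \<real>"
proof -
  have "(of_real x :: real) \<in> \<real>" by (rule Reals_of_real)
  then show ?thesis by simp
qed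

lemma coboundary_chain: "coboundary h \<in> chains1 G arev \<real>"
  by (auto simp: chains1_def coboundary_def real_in_Reals)

lemma coboundary_chain_int: "coboundary (\<lambda>v. of_int (h v)) \<in> chains1 G arev \<int>"
  by (auto simp: chains1_def coboundary_def)

text \<open>The reason why coboundaries are orthogonal to cycles.\<close>

lemma coboundary_adjoint:
  "chain_inner G (coboundary h) c = (\<Sum>v \<in> verts G. h v * boundary G c v)"
proof -
  have delta: "(\<Sum>v \<in> verts G. h v * of_bool (v = w)) = h w" if "w \<in> verts G" for w
  proof -
    have "(\<Sum>v \<in> verts G. h v * of_bool (v = w)) = (\<Sum>v \<in> verts G. if v = w then h v else 0)"
      by (rule sum.cong) auto
    then show ?thesis using that by simp
  qed
  have "(\<Sum>v \<in> verts G. h v * boundary G c v) =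
      (\<Sum>e \<in> arcs G. c e * (\<Sum>v \<in> verts G. h v * (of_bool (v = head G e) - of_bool (v = tail G e)))) / 2"
    unfolding boundary_def sum_distrib_left times_divide_eq_right sum_divide_distrib[symmetric]
    by (subst sum.swap) (simp add: mult.left_commute)
  also have "(\<Sum>e \<in> arcs G. c e * (\<Sum>v \<in> verts G. h v * (of_bool (v = head G e) - of_bool (v = tail G e)))) =
      (\<Sum>e \<in> arcs G. coboundary h e * c e)"
    by (rule sum.cong) (simp_all add: coboundary_def right_diff_distrib sum_subtractf delta algebra_simps)
  finally show ?thesis by (simp add: chain_inner_def)
qed

lemma coboundary_orthogonal_cycles:
  assumes "w \<in> cycles G arev \<real>"
  shows "chain_inner G (coboundary h) w = 0"
  using assms by (simp add: coboundary_adjoint cycles_def)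

lemma chain_inner_self_eq_0:
  assumes "c \<in> chains1 G arev \<real>" "chain_inner G c c = 0"
  shows "c = (\<lambda>_. 0)"
proof
  fix e
  have "(\<Sum>e \<in> arcs G. c e * c e) = 0" using assms(2) by (simp add: chain_inner_def)
  then have "\<forall>e \<in> arcs G. c e * c e = 0"
    by (subst (asm) sum_nonneg_eq_0_iff) auto
  then show "c e = 0" using assms(1) by (cases "e \<in> arcs G") (auto simp: chains1_def)
qed

lemma cycles_real_diff:
  assumes "z \<in> cycles G arev \<real>" "w \<in> cycles G arev \<real>"
  shows "(\<lambda>e. z e - w e) \<in> cycles G arev \<real>"
  using assms by (auto simp: cycles_def chains1_def boundary_diff real_in_Reals)

lemma cycles_int_diff:
  assumes "z \<in> cycles G arev \<int>" "w \<in> cycles G arev \<int>"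
  shows "(\<lambda>e. z e - w e) \<in> cycles G arev \<int>"
  using assms by (auto simp: cycles_def chains1_def boundary_diff)

lemma chains_int_diff:
  assumes "z \<in> chains1 G arev \<int>" "w \<in> chains1 G arev \<int>"
  shows "(\<lambda>e. z e - w e) \<in> chains1 G arev \<int>"
  using assms by (auto simp: chains1_def)

text \<open>
  Coboundaries are orthogonal to cycles, and definiteness of the inner product makes the projection
  unique; so it suffices to exhibit one cycle that differs from \<open>c\<close> by a coboundary.
\<close>

lemma cycle_proj_eqI:
  assumes z: "z \<in> cycles G arev \<real>" and c: "\<And>e. c e - z e = coboundary h e"
  shows "cycle_proj G arev c = z"
  unfolding cycle_proj_def
proof (rule the_equality)
  show "z \<in> cycles G arev \<real> \<and> (\<forall>w\<in>cycles G arev \<real>. chain_inner G (\<lambda>e. c e - z e) w = 0)"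
    using z coboundary_orthogonal_cycles unfolding c by simp
next
  fix y assume y: "y \<in> cycles G arev \<real> \<and> (\<forall>w\<in>cycles G arev \<real>. chain_inner G (\<lambda>e. c e - y e) w = 0)"
  define d where "d e = z e - y e" for e
  have d: "d \<in> cycles G arev \<real>" using cycles_real_diff[OF z] y by (simp add: d_def[abs_def])
  have "chain_inner G d d = chain_inner G (\<lambda>e. c e - y e) d - chain_inner G (\<lambda>e. c e - z e) d"
    by (simp add: chain_inner_def diff_divide_distrib[symmetric] sum_subtractf[symmetric]
        left_diff_distrib[symmetric] d_def)
  also have "\<dots> = 0" using y d coboundary_orthogonal_cycles[OF d] unfolding c by simp
  finally have "d = (\<lambda>_. 0)" using chain_inner_self_eq_0 d by (simp add: cycles_def)
  then show "y = z" by (auto simp: d_def fun_eq_iff)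
qed

lemma cycle_proj_cycle: "z \<in> cycles G arev \<real> \<Longrightarrow> cycle_proj G arev z = z"
  by (rule cycle_proj_eqI[of _ _ "\<lambda>_. 0"]) (auto simp: coboundary_def)

end

section \<open>Projections of integral chains\<close>

context rooted_multigraph
begin

lemma boundary_coboundary: "boundary G (coboundary (\<lambda>v. of_int (h v))) v = of_int (laplacian h v)"
  unfolding boundary_outgoing[OF coboundary_chain] laplacian_def
  by (simp add: coboundary_def sum_negf[symmetric])

text \<open>
  Integral chains do have a projection: a positive multiple of the boundary is a Laplacian, and the
  potential divided by the multiplier has the boundary of \<open>c\<close> as its Laplacian.
\<close>

lemma cycle_proj_decomposition:
  assumes c: "c \<in> chains1 G arev \<int>"
  obtains h where "cycle_proj G arev c \<in> cycles G arev \<real>"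
    "\<And>e. c e - cycle_proj G arev c e = coboundary h e"
proof -
  define D where "D v = \<lfloor>boundary G c v\<rfloor>" for v
  have D: "of_int (D v) = boundary G c v" for v
    using boundary_integer[OF c, of v] by (auto simp: D_def elim: Ints_cases)
  obtain n :: nat and h where n: "0 < n" and
    h: "\<And>v. v \<in> verts G - {q} \<Longrightarrow> int n * D v = laplacian h v"
    by (rule laplacian_multiple[of D]) blast
  define g :: "'v \<Rightarrow> real" where "g v = of_int (h v) / of_nat n" for v
  have g: "coboundary g e = 1 / of_nat n * coboundary (\<lambda>v. of_int (h v)) e" for e
    by (simp add: coboundary_def g_def diff_divide_distrib)
  define z where "z e = c e - coboundary g e" for e
  have bdy: "boundary G z v = boundary G c v - 1 / of_nat n * of_int (laplacian h v)" for v
    unfolding z_def boundary_diff g boundary_scale boundary_coboundary ..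
  have "boundary G z v = 0" if "v \<in> verts G - {q}" for v
  proof -
    have "of_int (laplacian h v) = real n * boundary G c v"
      unfolding h[OF that, symmetric] D[symmetric] by simp
    then show ?thesis unfolding bdy using n by simp
  qed
  then have "boundary G z v = 0" if "v \<in> verts G" for v
    using boundary_zero_everywhere[OF root _ that, of z] by blast
  moreover have "z \<in> chains1 G arev \<real>"
    using c coboundary_chain[of g] by (auto simp: chains1_def z_def real_in_Reals)
  ultimately have z: "z \<in> cycles G arev \<real>" by (simp add: cycles_def)
  have "cycle_proj G arev c = z"
    by (rule cycle_proj_eqI[OF z, of _ g]) (simp add: z_def)
  then show ?thesis using that[of g] z by (simp add: z_def)
qed

lemma cycle_proj_in_cycles: "c \<in> chains1 G arev \<int> \<Longrightarrow> cycle_proj G arev c \<in> cycles G arev \<real>"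
  by (rule cycle_proj_decomposition)

lemma cycle_proj_diff:
  assumes c: "c \<in> chains1 G arev \<int>" and d: "d \<in> chains1 G arev \<int>"
  shows "cycle_proj G arev (\<lambda>e. c e - d e) = (\<lambda>e. cycle_proj G arev c e - cycle_proj G arev d e)"
proof -
  obtain h where h: "\<And>e. c e - cycle_proj G arev c e = coboundary h e"
    using cycle_proj_decomposition[OF c] by metis
  obtain k where k: "\<And>e. d e - cycle_proj G arev d e = coboundary k e"
    using cycle_proj_decomposition[OF d] by metis
  show ?thesis
  proof (rule cycle_proj_eqI)
    show "(\<lambda>e. cycle_proj G arev c e - cycle_proj G arev d e) \<in> cycles G arev \<real>"
      by (intro cycles_real_diff cycle_proj_in_cycles c d)
    fix e
    have "coboundary (\<lambda>v. h v - k v) e = coboundary h e - coboundary k e"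
      by (simp add: coboundary_def)
    then show "c e - d e - (cycle_proj G arev c e - cycle_proj G arev d e) = coboundary (\<lambda>v. h v - k v) e"
      using h[of e] k[of e] by simp
  qed
qed

text \<open>
  Integrating along walks from \<open>q\<close> shows that \<open>h - h q\<close> is integer-valued.
\<close>

lemma integral_coboundary_potential:
  assumes "coboundary h \<in> chains1 G arev \<int>"
  obtains k :: "'v \<Rightarrow> int" where "coboundary h = coboundary (\<lambda>v. of_int (k v))"
proof -
  have step: "h (head G e) - h (tail G e) \<in> \<int>" if "e \<in> arcs G" for e
  proof -
    have "coboundary h e \<in> \<int>" using assms that by (simp add: chains1_def)
    then show ?thesis using that by (simp add: coboundary_def)
  qed
  have along: "h v - h u \<in> \<int>" if "awalk u p v" for u p v
    using that
  proof (induction p arbitrary: u)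
    case Nil
    then show ?case by (simp add: awalk_Nil_iff)
  next
    case (Cons e p)
    then have "h v - h (head G e) \<in> \<int>" "e \<in> arcs G" "u = tail G e"
      by (auto simp: awalk_Cons_iff)
    then have "(h v - h (head G e)) + (h (head G e) - h (tail G e)) \<in> \<int>"
      by (intro Ints_add step)
    then show ?case using \<open>u = tail G e\<close> by simp
  qed
  define k where "k v = \<lfloor>h v - h q\<rfloor>" for v
  have k: "of_int (k v) = h v - h q" if v: "v \<in> verts G" for v
  proof -
    obtain p where "awalk q p v" using walk_exists[OF root v] .
    then have "h v - h q \<in> \<int>" by (rule along)
    then show ?thesis by (auto simp: k_def elim: Ints_cases)
  qed
  have "coboundary h = coboundary (\<lambda>v. of_int (k v))"
    by (auto simp: coboundary_def k fun_eq_iff)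
  then show ?thesis by (rule that[of k])
qed

text \<open>
  With \<open>z\<close> the integral cycle by which the projections differ, \<open>c - d - z\<close> projects to \<open>0\<close>, hence is an
  integral coboundary. Taking boundaries removes \<open>z\<close>.
\<close>

lemma equivalent_projections_laplacian:
  assumes c: "c \<in> chains1 G arev \<int>" and d: "d \<in> chains1 G arev \<int>"
    and diff: "(\<lambda>e. cycle_proj G arev c e - cycle_proj G arev d e) \<in> cycles G arev \<int>"
  obtains h where "\<And>v. v \<in> verts G \<Longrightarrow> boundary G c v - boundary G d v = of_int (laplacian h v)"
proof -
  define z where "z e = cycle_proj G arev c e - cycle_proj G arev d e" for e
  have z: "z \<in> cycles G arev \<int>" using diff by (simp add: z_def[abs_def])
  define b where "b e = c e - d e" for e
  have b: "b \<in> chains1 G arev \<int>" unfolding b_def by (rule chains_int_diff[OF c d])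
  have "cycle_proj G arev b = z"
    unfolding b_def cycle_proj_diff[OF c d] by (simp add: z_def[abs_def])
  then obtain h where h: "\<And>e. b e - z e = coboundary h e"
    using cycle_proj_decomposition[OF b] by metis
  then have cob: "coboundary h = (\<lambda>e. b e - z e)" by (simp add: fun_eq_iff)
  then have "coboundary h \<in> chains1 G arev \<int>"
    using chains_int_diff[OF b, of z] z by (simp add: cycles_def)
  then obtain k :: "'v \<Rightarrow> int" where k: "coboundary h = coboundary (\<lambda>v. of_int (k v))"
    by (rule integral_coboundary_potential) blast
  have "boundary G c v - boundary G d v = of_int (laplacian k v)" if v: "v \<in> verts G" for v
  proof -
    have "of_int (laplacian k v) = boundary G (\<lambda>e. b e - z e) v"
      unfolding boundary_coboundary[symmetric] k[symmetric] cob ..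
    also have "\<dots> = boundary G b v" using z v by (simp add: boundary_diff cycles_def)
    finally show ?thesis by (simp add: b_def[abs_def] boundary_diff)
  qed
  then show ?thesis by (rule that)
qed

text \<open>
  The chain \<open>c - d - \<delta> h\<close> is an integral cycle and has the same projection as \<open>c - d\<close>. Agreement off
  \<open>q\<close> suffices because boundaries have total \<open>0\<close>.
\<close>

lemma laplacian_equivalent_projections:
  assumes c: "c \<in> chains1 G arev \<int>" and d: "d \<in> chains1 G arev \<int>"
    and h: "\<And>v. v \<in> verts G - {q} \<Longrightarrow> boundary G c v - boundary G d v = of_int (laplacian h v)"
  shows "(\<lambda>e. cycle_proj G arev c e - cycle_proj G arev d e) \<in> cycles G arev \<int>"
proof -
  define b where "b e = c e - d e" for e
  define z where "z e = b e - coboundary (\<lambda>v. of_int (h v)) e" for e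
  have b: "b \<in> chains1 G arev \<int>" unfolding b_def by (rule chains_int_diff[OF c d])
  have "boundary G z v = 0" if "v \<in> verts G - {q}" for v
    using h[OF that] unfolding z_def b_def boundary_diff boundary_coboundary by simp
  then have "boundary G z v = 0" if "v \<in> verts G" for v
    using boundary_zero_everywhere[OF root _ that, of z] by blast
  moreover have "z \<in> chains1 G arev \<int>"
    unfolding z_def by (rule chains_int_diff[OF b coboundary_chain_int])
  ultimately have z: "z \<in> cycles G arev \<int>" by (simp add: cycles_def)
  have "cycle_proj G arev b = z"
    by (rule cycle_proj_eqI[OF cycles_int_real[OF z], of _ "\<lambda>v. of_int (h v)"]) (simp add: z_def)
  then show ?thesis using z unfolding b_def cycle_proj_diff[OF c d] by simp
qed

end

section \<open>Chains of walks\<close>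

context multigraph
begin

lemma edge_chain_int: "e \<in> arcs G \<Longrightarrow> edge_chain arev e \<in> chains1 G arev \<int>"
  using arev_in_arcs[of e] arev_arev
  by (auto simp: chains1_def edge_chain_def of_bool_def arev_eq_iff)

lemma path_chain_Nil: "path_chain arev [] = (\<lambda>_. 0)"
  by (simp add: path_chain_def fun_eq_iff)

lemma path_chain_Cons: "path_chain arev (e # p) = (\<lambda>f. edge_chain arev e f + path_chain arev p f)"
  by (simp add: path_chain_def fun_eq_iff)

lemma path_chain_append: "path_chain arev (p @ p') = (\<lambda>f. path_chain arev p f + path_chain arev p' f)"
  by (simp add: path_chain_def fun_eq_iff)

lemma path_chain_int:
  assumes "set p \<subseteq> arcs G"
  shows "path_chain arev p \<in> chains1 G arev \<int>"
  using assms
proof (induction p)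
  case Nil
  then show ?case by (simp add: path_chain_Nil chains1_def)
next
  case (Cons e p)
  then have "path_chain arev p \<in> chains1 G arev \<int>" "edge_chain arev e \<in> chains1 G arev \<int>"
    using edge_chain_int by auto
  then show ?case by (auto simp: path_chain_Cons chains1_def)
qed

lemma boundary_path_chain:
  assumes "awalk u p w"
  shows "boundary G (path_chain arev p) v = of_bool (v = w) - of_bool (v = u)"
  using assms
proof (induction p arbitrary: u)
  case Nil
  then show ?case by (simp add: path_chain_Nil boundary_zero awalk_Nil_iff)
next
  case (Cons e p)
  then have e: "e \<in> arcs G" "u = tail G e" "awalk (head G e) p w"
    by (auto simp: awalk_Cons_iff)
  then show ?case
    using Cons.IH[OF e(3)] by (simp add: path_chain_Cons boundary_add boundary_edge_chain)
qed

lemma reverse_walk: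
  assumes "awalk u p w"
  shows "awalk w (map arev (rev p)) u"
    "path_chain arev (map arev (rev p)) = (\<lambda>e. - path_chain arev p e)"
proof -
  show "awalk w (map arev (rev p)) u"
    using assms
  proof (induction p arbitrary: u)
    case (Cons e p)
    then have "awalk w (map arev (rev p)) (head G e)" "e \<in> arcs G" "u = tail G e"
      by (auto simp: awalk_Cons_iff)
    then show ?case by (auto simp: awalk_simps intro!: awalk_appendI)
  qed (simp add: awalk_Nil_iff)
  have rev: "edge_chain arev (arev e) f = - edge_chain arev e f" for e f
    by (simp add: edge_chain_def)
  show "path_chain arev (map arev (rev p)) = (\<lambda>e. - path_chain arev p e)"
    by (induction p) (simp_all add: path_chain_Nil path_chain_Cons path_chain_append rev fun_eq_iff)
qed

lemma closed_walk_chain_multiple: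
  assumes "awalk u p u"
  shows "\<exists>p'. awalk u p' u \<and> path_chain arev p' = (\<lambda>e. of_int n * path_chain arev p e)"
proof -
  have nat: "\<exists>p'. awalk u p' u \<and> path_chain arev p' = (\<lambda>e. of_nat k * path_chain arev p e)" for k :: nat
  proof (induction k)
    case 0
    have "awalk u [] u" using assms by (auto simp: awalk_Nil_iff)
    then show ?case by (intro exI[of _ "[]"]) (simp add: path_chain_Nil)
  next
    case (Suc k)
    then obtain p' where p': "awalk u p' u" "path_chain arev p' = (\<lambda>e. of_nat k * path_chain arev p e)"
      by blast
    then show ?case using assms
      by (intro exI[of _ "p @ p'"]) (auto simp: path_chain_append algebra_simps)
  qed
  show ?thesis
  proof (cases "0 \<le> n")
    case True
    then show ?thesis using nat[of "nat n"] by simp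
  next
    case False
    obtain p' where p': "awalk u p' u" "path_chain arev p' = (\<lambda>e. of_nat (nat (- n)) * path_chain arev p e)"
      using nat[of "nat (- n)"] by blast
    then show ?thesis using reverse_walk[OF p'(1)] False
      by (intro exI[of _ "map arev (rev p')"]) simp
  qed
qed

lemma closed_walk_chain_sum:
  assumes "finite I" "u \<in> verts G" "\<And>i. i \<in> I \<Longrightarrow> \<exists>p. awalk u p u \<and> path_chain arev p = c i"
  shows "\<exists>p. awalk u p u \<and> path_chain arev p = (\<lambda>e. \<Sum>i \<in> I. c i e)"
  using assms(1,3)
proof (induction I rule: finite_induct)
  case empty
  then show ?case using assms(2)
    by (intro exI[of _ "[]"]) (simp add: awalk_Nil_iff path_chain_Nil)
next
  case (insert i I)
  then obtain p p' where "awalk u p u" "path_chain arev p = c i" "awalk u p' u"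
    "path_chain arev p' = (\<lambda>e. \<Sum>i \<in> I. c i e)"
    by (metis insert_iff)
  then show ?case using insert.hyps
    by (intro exI[of _ "p @ p'"]) (auto simp: path_chain_append)
qed

end

context rooted_multigraph
begin

text \<open>
  Choose a walk from \<open>q\<close> to every vertex and attach to each arc the loop at \<open>q\<close> through it. In an
  integer combination of these loops with the coefficients of \<open>z\<close>, every chosen walk to a vertex
  \<open>v\<close> occurs with the coefficient of \<open>- \<partial> z\<close> at \<open>v\<close>, which is \<open>0\<close>. Chains of closed walks at \<open>q\<close> are closed
  under integer combinations by concatenation and reversal.
\<close>

theorem integral_cycle_is_closed_walk_chain:
  assumes z: "z \<in> cycles G arev \<int>"
  obtains p where "awalk q p q" "path_chain arev p = z"
proof -
  have "z \<in> chains1 G arev \<int>" using z by (simp add: cycles_def)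
  then obtain a where a: "\<And>e. e \<in> arcs G \<Longrightarrow> a e \<in> \<int>"
    and z_eq: "z = (\<lambda>f. \<Sum>e \<in> arcs G. a e * edge_chain arev e f)"
    using chains_presentation_generators[of \<int>] by auto
  have "\<exists>w. awalk q w v" if "v \<in> verts G" for v
    using walk_exists[OF root that] by blast
  then obtain w where w: "\<And>v. v \<in> verts G \<Longrightarrow> awalk q (w v) v" by metis
  define loop where "loop e = w (tail G e) @ [e] @ map arev (rev (w (head G e)))" for e
  have loop: "awalk q (loop e) q" if "e \<in> arcs G" for e
    unfolding loop_def using that w[of "tail G e"] reverse_walk(1)[OF w[of "head G e"]]
    by (intro awalk_appendI) (auto simp: awalk_simps)
  have loop_chain: "path_chain arev (loop e) f =
      edge_chain arev e f - (path_chain arev (w (head G e)) f - path_chain arev (w (tail G e)) f)"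
    if "e \<in> arcs G" for e f
    unfolding loop_def path_chain_append path_chain_Cons path_chain_Nil
      reverse_walk(2)[OF w[OF head_in_verts[OF that]]] by simp
  have "\<exists>p. awalk q p q \<and> path_chain arev p = (\<lambda>f. a e * path_chain arev (loop e) f)"
    if e: "e \<in> arcs G" for e
  proof -
    obtain n where "a e = of_int n" using a[OF e] by (auto elim: Ints_cases)
    then show ?thesis using closed_walk_chain_multiple[OF loop[OF e], of n] by simp
  qed
  then obtain p where p: "awalk q p q"
    "path_chain arev p = (\<lambda>f. \<Sum>e \<in> arcs G. a e * path_chain arev (loop e) f)"
    using closed_walk_chain_sum[OF finite_arcs root, of "\<lambda>e f. a e * path_chain arev (loop e) f"]
    by blast
  have "(\<Sum>e \<in> arcs G. a e * path_chain arev (loop e) f) = z f" for f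
  proof -
    define g where "g v = path_chain arev (w v) f" for v
    have anti: "coboundary g (arev e) = - coboundary g e" if "e \<in> arcs G" for e
      using that by (simp add: coboundary_def)
    have "0 = chain_inner G (coboundary g) z"
      using coboundary_orthogonal_cycles[OF cycles_int_real[OF z]] by simp
    also have "\<dots> = (\<Sum>e \<in> arcs G. coboundary g e * (a e - a (arev e))) / 2"
      unfolding chain_inner_def z_eq sum_scaled_edge_chain by simp
    also have "(\<Sum>e \<in> arcs G. coboundary g e * (a e - a (arev e))) =
        (\<Sum>e \<in> arcs G. coboundary g e * a e) + (\<Sum>e \<in> arcs G. coboundary g (arev e) * a (arev e))"
      unfolding sum.distrib[symmetric] by (rule sum.cong) (simp_all add: anti algebra_simps)
    also have "(\<Sum>e \<in> arcs G. coboundary g (arev e) * a (arev e)) = (\<Sum>e \<in> arcs G. coboundary g e * a e)"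
      by (rule sum_arev)
    finally have "(\<Sum>e \<in> arcs G. coboundary g e * a e) = 0" by simp
    moreover have "(\<Sum>e \<in> arcs G. a e * path_chain arev (loop e) f) =
        z f - (\<Sum>e \<in> arcs G. coboundary g e * a e)"
      unfolding z_eq sum_subtractf[symmetric]
      by (rule sum.cong) (simp_all add: loop_chain coboundary_def g_def algebra_simps)
    ultimately show ?thesis by simp
  qed
  then show ?thesis using that p by simp
qed

end

section \<open>Groups of chains and their translations\<close>

definition chain_subgroup :: "('e \<Rightarrow> real) set \<Rightarrow> bool" where
  "chain_subgroup M \<longleftrightarrow> (\<lambda>_. 0) \<in> M \<and> (\<forall>a \<in> M. \<forall>b \<in> M. (\<lambda>e. a e - b e) \<in> M)"

text \<open>
  The common form of the orbits of the translation action and of the cosets of the quotient group.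
\<close>

definition chain_coset :: "('e \<Rightarrow> real) set \<Rightarrow> ('e \<Rightarrow> real) \<Rightarrow> ('e \<Rightarrow> real) set" where
  "chain_coset M a = {\<lambda>e. a e + z e | z. z \<in> M}"

lemma chain_subgroup_zero: "chain_subgroup M \<Longrightarrow> (\<lambda>_. 0) \<in> M"
  by (simp add: chain_subgroup_def)

lemma chain_subgroup_diff: "chain_subgroup M \<Longrightarrow> a \<in> M \<Longrightarrow> b \<in> M \<Longrightarrow> (\<lambda>e. a e - b e) \<in> M"
  by (simp add: chain_subgroup_def)

lemma chain_subgroup_uminus: "chain_subgroup M \<Longrightarrow> a \<in> M \<Longrightarrow> (\<lambda>e. - a e) \<in> M"
  using chain_subgroup_diff[OF _ chain_subgroup_zero, of M a] by simp

lemma chain_subgroup_add: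
  assumes "chain_subgroup M" "a \<in> M" "b \<in> M"
  shows "(\<lambda>e. a e + b e) \<in> M"
  using chain_subgroup_diff[OF assms(1,2) chain_subgroup_uminus[OF assms(1,3)]] by simp

lemma comm_group_chain_group:
  assumes "chain_subgroup M"
  shows "comm_group (chain_group M)"
proof (rule comm_groupI)
  show "\<one>\<^bsub>chain_group M\<^esub> \<in> carrier (chain_group M)"
    using assms by (simp add: chain_group_def chain_subgroup_def)
next
  fix a assume "a \<in> carrier (chain_group M)"
  then show "\<exists>b\<in>carrier (chain_group M). b \<otimes>\<^bsub>chain_group M\<^esub> a = \<one>\<^bsub>chain_group M\<^esub>"
    using chain_subgroup_uminus[OF assms, of a]
    by (intro bexI[of _ "\<lambda>e. - a e"]) (simp_all add: chain_group_def)
qed (simp_all add: chain_group_def chain_subgroup_add[OF assms] algebra_simps)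

lemma chain_coset_eq_iff:
  assumes M: "chain_subgroup M"
  shows "chain_coset M a = chain_coset M b \<longleftrightarrow> (\<lambda>e. a e - b e) \<in> M"
proof
  assume eq: "chain_coset M a = chain_coset M b"
  have "a \<in> chain_coset M a"
    using M by (auto simp: chain_coset_def chain_subgroup_def intro!: exI[of _ "\<lambda>_. 0"])
  then obtain z where "z \<in> M" "a = (\<lambda>e. b e + z e)" unfolding eq by (auto simp: chain_coset_def)
  then show "(\<lambda>e. a e - b e) \<in> M" by simp
next
  assume d: "(\<lambda>e. a e - b e) \<in> M"
  have "chain_coset M a \<subseteq> chain_coset M b" if "(\<lambda>e. a e - b e) \<in> M" for a b
  proof
    fix c assume "c \<in> chain_coset M a"
    then obtain z where z: "z \<in> M" "c = (\<lambda>e. a e + z e)" by (auto simp: chain_coset_def)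
    have "(\<lambda>e. (a e - b e) + z e) \<in> M" by (rule chain_subgroup_add[OF M that z(1)])
    then show "c \<in> chain_coset M b"
      unfolding chain_coset_def z(2) by (intro CollectI exI[of _ "\<lambda>e. (a e - b e) + z e"]) simp
  qed
  from this[OF d] this[of b a] chain_subgroup_uminus[OF M d]
  show "chain_coset M a = chain_coset M b" by simp
qed

lemma group_action_translation:
  assumes M: "chain_subgroup M"
    and S: "\<And>a z. a \<in> S \<Longrightarrow> z \<in> M \<Longrightarrow> (\<lambda>e. a e + z e) \<in> S"
  shows "group_action (chain_group M) S (translation S)"
proof -
  interpret M: comm_group "chain_group M" by (rule comm_group_chain_group[OF M])
  have Bij: "translation S z \<in> Bij S" if z: "z \<in> M" for z
  proof -
    have "bij_betw (translation S z) S S"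
    proof (rule bij_betw_byWitness[of _ "translation S (\<lambda>e. - z e)"])
      show "\<forall>a\<in>S. translation S (\<lambda>e. - z e) (translation S z a) = a"
        using S[OF _ z] by (simp add: translation_def)
      show "\<forall>a\<in>S. translation S z (translation S (\<lambda>e. - z e) a) = a"
        using S[OF _ chain_subgroup_uminus[OF M z]] by (simp add: translation_def)
      show "translation S z ` S \<subseteq> S"
        using S[OF _ z] by (auto simp: translation_def)
      show "translation S (\<lambda>e. - z e) ` S \<subseteq> S"
        using S[OF _ chain_subgroup_uminus[OF M z]] by (auto simp: translation_def)
    qed
    then show ?thesis by (simp add: Bij_def translation_def)
  qed
  show ?thesis
    unfolding group_action_def
  proof (intro group_hom.intro group_hom_axioms.intro group_BijGroup homI)
    show "Group.group (chain_group M)" by (rule M.is_group)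
  next
    fix z assume "z \<in> carrier (chain_group M)"
    then show "translation S z \<in> carrier (BijGroup S)"
      using Bij by (simp add: BijGroup_def chain_group_def)
  next
    fix z w assume zw: "z \<in> carrier (chain_group M)" "w \<in> carrier (chain_group M)"
    then have zw': "z \<in> M" "w \<in> M" by (simp_all add: chain_group_def)
    have "translation S (\<lambda>e. z e + w e) = compose S (translation S z) (translation S w)"
      using S[OF _ zw'(2)] by (auto simp: translation_def compose_def fun_eq_iff)
    then show "translation S (z \<otimes>\<^bsub>chain_group M\<^esub> w) =
        translation S z \<otimes>\<^bsub>BijGroup S\<^esub> translation S w"
      using Bij zw' by (simp add: BijGroup_def chain_group_def)
  qed
qed

lemma normal_chain_group:
  assumes M: "chain_subgroup M" and N: "chain_subgroup N" and sub: "N \<subseteq> M"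
  shows "N \<lhd> chain_group M"
proof -
  interpret M: comm_group "chain_group M" by (rule comm_group_chain_group[OF M])
  have inv: "inv\<^bsub>chain_group M\<^esub> a = (\<lambda>e. - a e)" if "a \<in> M" for a
    using that chain_subgroup_uminus[OF M that]
    by (intro M.inv_equality) (simp_all add: chain_group_def)
  have "subgroup N (chain_group M)"
  proof
    show "N \<subseteq> carrier (chain_group M)" using sub by (simp add: chain_group_def)
    show "\<one>\<^bsub>chain_group M\<^esub> \<in> N" using N by (simp add: chain_group_def chain_subgroup_def)
    fix a assume a: "a \<in> N"
    show "inv\<^bsub>chain_group M\<^esub> a \<in> N"
      using inv[of a] a sub chain_subgroup_uminus[OF N a] by auto
    fix b assume "b \<in> N"
    then show "a \<otimes>\<^bsub>chain_group M\<^esub> b \<in> N"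
      using chain_subgroup_add[OF N a] by (simp add: chain_group_def)
  qed
  then show ?thesis by (rule M.subgroup_imp_normal)
qed

lemma orbit_translation: "a \<in> S \<Longrightarrow> Group_Action.orbit (chain_group M) (translation S) a = chain_coset M a"
  by (auto simp: Group_Action.orbit_def translation_def chain_group_def chain_coset_def)

lemma rcoset_chain_group: "N #>\<^bsub>chain_group M\<^esub> a = chain_coset N a"
  by (auto simp: r_coset_def chain_group_def chain_coset_def add.commute)

section \<open>Orbits of atoms and cosets of the lattice\<close>

context rooted_multigraph
begin

lemma chain_subgroup_cycles: "chain_subgroup (cycles G arev \<int>)"
  using cycles_int_diff by (auto simp: chain_subgroup_def cycles_def chains1_def boundary_zero)

lemma chain_subgroup_proj_lattice: "chain_subgroup (proj_lattice G arev)"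
  unfolding chain_subgroup_def
proof (intro conjI ballI)
  have 0: "(\<lambda>_. 0) \<in> cycles G arev \<int>"
    using chain_subgroup_cycles by (simp add: chain_subgroup_def)
  then have "cycle_proj G arev (\<lambda>_. 0) = (\<lambda>_. 0)"
    by (intro cycle_proj_cycle cycles_int_real)
  moreover have "(\<lambda>_. 0) \<in> chains1 G arev \<int>" using 0 by (simp add: cycles_def)
  ultimately show "(\<lambda>_. 0) \<in> proj_lattice G arev" by (metis proj_lattice_def image_eqI)
next
  fix a b assume "a \<in> proj_lattice G arev" "b \<in> proj_lattice G arev"
  then obtain c d where cd: "c \<in> chains1 G arev \<int>" "d \<in> chains1 G arev \<int>"
    "a = cycle_proj G arev c" "b = cycle_proj G arev d"
    by (auto simp: proj_lattice_def)
  show "(\<lambda>e. a e - b e) \<in> proj_lattice G arev"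
    unfolding cd(3,4) cycle_proj_diff[OF cd(1,2), symmetric] proj_lattice_def
    by (rule imageI) (rule chains_int_diff[OF cd(1,2)])
qed

lemma cycle_proj_add_cycle:
  assumes "c \<in> chains1 G arev \<int>" "z \<in> cycles G arev \<int>"
  shows "cycle_proj G arev (\<lambda>e. c e + z e) = (\<lambda>e. cycle_proj G arev c e + z e)"
proof -
  define w where "w e = - z e" for e
  have w: "w \<in> cycles G arev \<int>"
    using chain_subgroup_uminus[OF chain_subgroup_cycles assms(2)] by (simp add: w_def[abs_def])
  then have "w \<in> chains1 G arev \<int>" by (simp add: cycles_def)
  from cycle_proj_diff[OF assms(1) this] show ?thesis
    unfolding cycle_proj_cycle[OF cycles_int_real[OF w]] by (simp add: w_def)
qed

lemma awalk_chain_int: "awalk u p v \<Longrightarrow> path_chain arev p \<in> chains1 G arev \<int>"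
  by (rule path_chain_int) (simp add: awalk_def)

lemma atomsE:
  assumes "a \<in> atoms G arev q"
  obtains p x where "x \<in> verts G" "awalk q p x" "a = cycle_proj G arev (path_chain arev p)"
  using assms by (auto simp: atoms_def)

text \<open>Precede the path by a closed walk at \<open>q\<close> that realises the cycle.\<close>

lemma atoms_chain_coset_closed:
  assumes "a \<in> atoms G arev q" and z: "z \<in> cycles G arev \<int>"
  shows "(\<lambda>e. a e + z e) \<in> atoms G arev q"
proof -
  obtain p x where p: "x \<in> verts G" "awalk q p x" "a = cycle_proj G arev (path_chain arev p)"
    using assms(1) by (rule atomsE) blast
  obtain p' where p': "awalk q p' q" "path_chain arev p' = z"
    by (rule integral_cycle_is_closed_walk_chain[OF z]) blast
  have "awalk q (p' @ p) x" using p'(1) p(2) by (rule awalk_appendI)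
  moreover have "path_chain arev (p' @ p) = (\<lambda>e. path_chain arev p e + z e)"
    by (simp add: path_chain_append p'(2) add.commute)
  then have "(\<lambda>e. a e + z e) = cycle_proj G arev (path_chain arev (p' @ p))"
    using cycle_proj_add_cycle[OF awalk_chain_int[OF p(2)] z] p(3) by simp
  ultimately show ?thesis unfolding atoms_def using p(1) by blast
qed

lemma cycles_subset_atoms: "cycles G arev \<int> \<subseteq> atoms G arev q"
proof
  fix z assume z: "z \<in> cycles G arev \<int>"
  obtain p where p: "awalk q p q" "path_chain arev p = z"
    by (rule integral_cycle_is_closed_walk_chain[OF z]) blast
  have "z = cycle_proj G arev (path_chain arev p)"
    unfolding p(2) using cycle_proj_cycle[OF cycles_int_real[OF z]] by simp
  then show "z \<in> atoms G arev q" using p(1) root by (auto simp: atoms_def)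
qed

lemma atoms_subset_proj_lattice: "atoms G arev q \<subseteq> proj_lattice G arev"
  using awalk_chain_int by (auto simp: atoms_def proj_lattice_def)

lemma proj_lattice_subset_cycles: "proj_lattice G arev \<subseteq> cycles G arev \<real>"
  using cycle_proj_in_cycles by (auto simp: proj_lattice_def)

lemma cycles_subset_proj_lattice: "cycles G arev \<int> \<subseteq> proj_lattice G arev"
  using cycles_subset_atoms atoms_subset_proj_lattice by blast

text \<open>
  The boundaries of the two path chains differ by \<open>x - y\<close>, which is the Laplacian of an integer function
  only if \<open>x = y\<close>.
\<close>

lemma atoms_equivalent_iff:
  assumes bridgeless: "\<nexists>e. bridge G arev e"
    and p: "awalk q p x" and p': "awalk q p' y"
  shows "chain_coset (cycles G arev \<int>) (cycle_proj G arev (path_chain arev p)) =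
      chain_coset (cycles G arev \<int>) (cycle_proj G arev (path_chain arev p')) \<longleftrightarrow> x = y"
  unfolding chain_coset_eq_iff[OF chain_subgroup_cycles]
proof
  assume "(\<lambda>e. cycle_proj G arev (path_chain arev p) e - cycle_proj G arev (path_chain arev p') e)
      \<in> cycles G arev \<int>"
  then obtain h where h: "\<And>v. v \<in> verts G \<Longrightarrow>
      boundary G (path_chain arev p) v - boundary G (path_chain arev p') v = of_int (laplacian h v)"
    by (rule equivalent_projections_laplacian[OF awalk_chain_int[OF p] awalk_chain_int[OF p']]) blast
  have "laplacian h v = of_bool (v = x) - of_bool (v = y)" if "v \<in> verts G" for v
  proof -
    have "real_of_int (laplacian h v) = real_of_int (of_bool (v = x) - of_bool (v = y))"
      unfolding h[OF that, symmetric] boundary_path_chain[OF p] boundary_path_chain[OF p'] by simp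
    then show ?thesis by (simp only: of_int_eq_iff)
  qed
  then show "x = y"
    using bridgeless_vertices_inequivalent[OF bridgeless] p p' awalk_last_in_verts by blast
next
  assume "x = y"
  have "laplacian (\<lambda>_. 0) v = 0" for v by (rule laplacian_const) simp
  then show "(\<lambda>e. cycle_proj G arev (path_chain arev p) e - cycle_proj G arev (path_chain arev p') e)
      \<in> cycles G arev \<int>"
    using \<open>x = y\<close>
    by (intro laplacian_equivalent_projections[where h = "\<lambda>_. 0"] awalk_chain_int[OF p] awalk_chain_int[OF p'])
      (simp add: boundary_path_chain[OF p] boundary_path_chain[OF p'])
qed

theorem card_atom_orbits:
  assumes bridgeless: "\<nexists>e. bridge G arev e"
  shows "card (atom_orbits G arev q) = card (verts G)"
proof -
  have "\<exists>w. awalk q w v" if "v \<in> verts G" for v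
    using walk_exists[OF root that] by blast
  then obtain w where w: "\<And>v. v \<in> verts G \<Longrightarrow> awalk q (w v) v" by metis
  define orb where "orb v = chain_coset (cycles G arev \<int>) (cycle_proj G arev (path_chain arev (w v)))" for v
  have "atom_orbits G arev q = chain_coset (cycles G arev \<int>) ` atoms G arev q"
    unfolding atom_orbits_def orbits_def Setcompr_eq_image
    by (rule image_cong) (simp_all add: orbit_translation)
  also have "\<dots> = orb ` verts G"
  proof (intro Set.set_eqI iffI)
    fix B assume "B \<in> chain_coset (cycles G arev \<int>) ` atoms G arev q"
    then obtain a where a: "a \<in> atoms G arev q" "B = chain_coset (cycles G arev \<int>) a" by blast
    obtain p x where p: "x \<in> verts G" "awalk q p x" "a = cycle_proj G arev (path_chain arev p)"
      using a(1) by (rule atomsE) blast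
    have "B = orb x"
      unfolding a(2) p(3) orb_def using atoms_equivalent_iff[OF bridgeless p(2) w[OF p(1)]] by blast
    then show "B \<in> orb ` verts G" using p(1) by blast
  next
    fix B assume "B \<in> orb ` verts G"
    then obtain v where v: "v \<in> verts G" "B = orb v" by blast
    then have "cycle_proj G arev (path_chain arev (w v)) \<in> atoms G arev q"
      using w[OF v(1)] by (auto simp: atoms_def)
    then show "B \<in> chain_coset (cycles G arev \<int>) ` atoms G arev q" using v(2) by (simp add: orb_def)
  qed
  finally have "atom_orbits G arev q = orb ` verts G" .
  moreover have "inj_on orb (verts G)"
    using atoms_equivalent_iff[OF bridgeless w w] by (auto simp: inj_on_def orb_def)
  ultimately show ?thesis by (simp add: card_image)
qed

text \<open>
  Sum the chains of walks from \<open>q\<close> to the vertices, weighted by the prescribed values.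
\<close>

lemma chain_with_boundary:
  obtains c where "c \<in> chains1 G arev \<int>"
    "\<And>v. v \<in> verts G - {q} \<Longrightarrow> boundary G c v = of_nat (f v)"
proof -
  have "\<exists>w. awalk q w v" if "v \<in> verts G" for v
    using walk_exists[OF root that] by blast
  then obtain w where w: "\<And>v. v \<in> verts G \<Longrightarrow> awalk q (w v) v" by metis
  define c where "c e = (\<Sum>v \<in> verts G. of_nat (f v) * path_chain arev (w v) e)" for e
  have chain: "path_chain arev (w v) \<in> chains1 G arev \<int>" if "v \<in> verts G" for v
    using awalk_chain_int[OF w[OF that]] .
  have "c \<in> chains1 G arev \<int>"
    using chain unfolding chains1_def c_def
    by (auto intro!: Ints_sum Ints_mult simp: sum_negf[symmetric])
  moreover have "boundary G c v = of_nat (f v)" if v: "v \<in> verts G - {q}" for v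
  proof -
    have "boundary G c v = (\<Sum>u \<in> verts G. of_nat (f u) * boundary G (path_chain arev (w u)) v)"
      unfolding c_def boundary_sum boundary_scale ..
    also have "\<dots> = (\<Sum>u \<in> verts G. if u = v then of_nat (f u) else 0)"
      by (rule sum.cong) (use v in \<open>auto simp: boundary_path_chain[OF w]\<close>)
    also have "\<dots> = of_nat (f v)" using v by simp
    finally show ?thesis .
  qed
  ultimately show ?thesis by (rule that)
qed

text \<open>
  Sending a parking function to the class of a chain that has it as its boundary off \<open>q\<close> is a bijection,
  by existence and uniqueness of parking representatives.
\<close>

theorem order_lattice_quotient:
  "order (lattice_quotient G arev) = card (undirected_spanning_trees G arev)"
proof -
  have "\<exists>c. c \<in> chains1 G arev \<int> \<and> (\<forall>v \<in> verts G - {q}. boundary G c v = of_nat (f v))" for f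
    by (rule chain_with_boundary[of f]) blast
  then obtain c where c: "\<And>f. c f \<in> chains1 G arev \<int>"
    and bdy: "\<And>f v. v \<in> verts G - {q} \<Longrightarrow> boundary G (c f) v = of_nat (f v)"
    by metis
  define coset where "coset f = chain_coset (cycles G arev \<int>) (cycle_proj G arev (c f))" for f
  have "carrier (lattice_quotient G arev) = chain_coset (cycles G arev \<int>) ` proj_lattice G arev"
    unfolding lattice_quotient_def FactGroup_def RCOSETS_def
    by (auto simp: rcoset_chain_group) (auto simp: chain_group_def)
  also have "\<dots> = coset ` parking {q} (arcs G)"
  proof (intro Set.set_eqI iffI)
    fix B assume "B \<in> chain_coset (cycles G arev \<int>) ` proj_lattice G arev"
    then obtain b where b: "b \<in> chains1 G arev \<int>" "B = chain_coset (cycles G arev \<int>) (cycle_proj G arev b)"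
      by (auto simp: proj_lattice_def)
    define D where "D v = \<lfloor>boundary G b v\<rfloor>" for v
    have D: "of_int (D v) = boundary G b v" for v
      using boundary_integer[OF b(1), of v] by (auto simp: D_def elim: Ints_cases)
    obtain h f where f: "f \<in> parking {q} (arcs G)"
      and h: "\<And>v. v \<in> verts G - {q} \<Longrightarrow> int (f v) = D v + laplacian h v"
      by (rule parking_representative_exists[of D]) blast
    have "boundary G (c f) v - boundary G b v = of_int (laplacian h v)" if "v \<in> verts G - {q}" for v
    proof -
      have "real_of_int (int (f v)) = of_int (D v + laplacian h v)" using h[OF that] by simp
      then show ?thesis unfolding bdy[OF that] D[symmetric] by simp
    qed
    then have "coset f = B"
      unfolding coset_def b(2) chain_coset_eq_iff[OF chain_subgroup_cycles]
      by (rule laplacian_equivalent_projections[OF c b(1)])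
    then show "B \<in> coset ` parking {q} (arcs G)" using f by blast
  next
    fix B assume "B \<in> coset ` parking {q} (arcs G)"
    then show "B \<in> chain_coset (cycles G arev \<int>) ` proj_lattice G arev"
      using c by (auto simp: coset_def proj_lattice_def)
  qed
  finally have "carrier (lattice_quotient G arev) = coset ` parking {q} (arcs G)" .
  moreover have "inj_on coset (parking {q} (arcs G))"
  proof (rule inj_onI)
    fix f g assume f: "f \<in> parking {q} (arcs G)" and g: "g \<in> parking {q} (arcs G)"
      and "coset f = coset g"
    then have "(\<lambda>e. cycle_proj G arev (c f) e - cycle_proj G arev (c g) e) \<in> cycles G arev \<int>"
      by (simp add: coset_def chain_coset_eq_iff[OF chain_subgroup_cycles])
    then obtain h where h: "\<And>v. v \<in> verts G \<Longrightarrow>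
        boundary G (c f) v - boundary G (c g) v = of_int (laplacian h v)"
      by (rule equivalent_projections_laplacian[OF c c]) blast
    have "int (f v) - int (g v) = laplacian h v" if v: "v \<in> verts G - {q}" for v
    proof -
      have "real_of_int (int (f v) - int (g v)) = of_int (laplacian h v)"
        using h[of v] v unfolding bdy[OF v] by simp
      then show ?thesis by (simp only: of_int_eq_iff)
    qed
    then show "f = g" by (rule parking_representative_unique[OF f g])
  qed
  ultimately show ?thesis
    unfolding order_def by (simp add: card_image card_parking_eq_card_spanning_trees(2)[OF root])
qed

end

theorem theorem14:
  fixes G :: "('v, 'e) pre_digraph" and arev :: "'e \<Rightarrow> 'e" and x\<^sub>0 :: 'v
  assumes "bidirected_digraph G arev"
    and "fin_digraph G"
    and "Digraph_Component.connected G"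
    and "\<nexists>e. bridge G arev e"
    and "x\<^sub>0 \<in> verts G"
  shows "cycles G arev \<int> \<subseteq> atoms G arev x\<^sub>0 \<and>
    atoms G arev x\<^sub>0 \<subseteq> proj_lattice G arev \<and>
    proj_lattice G arev \<subseteq> cycles G arev \<real> \<and>
    group_action (chain_group (cycles G arev \<int>)) (atoms G arev x\<^sub>0)
      (translation (atoms G arev x\<^sub>0)) \<and>
    group_action (chain_group (cycles G arev \<int>)) (proj_lattice G arev)
      (translation (proj_lattice G arev)) \<and>
    cycles G arev \<int> \<lhd> chain_group (proj_lattice G arev) \<and>
    packing_fraction G arev x\<^sub>0 =
      real (card (verts G)) / real (card (undirected_spanning_trees G arev)) \<and>
    card (atom_orbits G arev x\<^sub>0) = card (verts G) \<and>
    order (lattice_quotient G arev) = card (undirected_spanning_trees G arev)"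
proof -
  interpret rooted_multigraph G arev x\<^sub>0
    using assms by (intro rooted_multigraph.intro multigraph.intro rooted_multigraph_axioms.intro)
  have lattice: "(\<lambda>e. a e + z e) \<in> proj_lattice G arev"
    if "a \<in> proj_lattice G arev" "z \<in> cycles G arev \<int>" for a z
    using that cycles_subset_proj_lattice
    by (intro chain_subgroup_add[OF chain_subgroup_proj_lattice]) auto
  have "packing_fraction G arev x\<^sub>0 =
      real (card (verts G)) / real (card (undirected_spanning_trees G arev))"
    unfolding packing_fraction_def card_atom_orbits[OF assms(4)] order_lattice_quotient ..
  then show ?thesis
    using cycles_subset_atoms atoms_subset_proj_lattice proj_lattice_subset_cycles
      group_action_translation[OF chain_subgroup_cycles atoms_chain_coset_closed]
      group_action_translation[OF chain_subgroup_cycles lattice]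
      normal_chain_group[OF chain_subgroup_proj_lattice chain_subgroup_cycles cycles_subset_proj_lattice]
      card_atom_orbits[OF assms(4)] order_lattice_quotient
    by blast
qed

end
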